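(* Let $m \in \mathbb{N}$ (so $m\ge 1$) and $\alpha \in (0,1)$. Define $f_k(z)$ and $\alpha_k$ recursively by $$f_{k+1}(z) = f_k(z)\, \hat{r}_{m,m-1}\!\left( \frac{z}{f_k(z)^2}, \alpha_k \right),\quad f_0(z) = 1,\qquad \alpha_{k+1} = \frac{\alpha_k}{\hat{r}_{m,m-1}(\alpha_k^2,\alpha_k)},\quad \alpha_0 = \alpha.$$ Then, for every $k \ge 1$, $$f_k(z) = \hat{r}_{q,q-1}(z,\alpha) = \frac{1+\alpha_k}{2\alpha_k}\, r_{q,q-1}(z,\alpha), \qquad q = \tfrac{1}{2}(2m)^k.$$ If instead $$f_{k+1}(z) = f_k(z)\, \hat{r}_{m,m}\!\left( \frac{z}{f_k(z)^2}, \alpha_k \right),\quad f_0(z) = 1,\qquad \alpha_{k+1} = \frac{\alpha_k}{\hat{r}_{m,m}(\alpha_k^2,\alpha_k)},\quad \alpha_0 = \alpha,$$ then, for every $k \ge 1$, $$f_k(z) = \hat{r}_{q,q}(z,\alpha) = \frac{1+\alpha_k}{2\alpha_k}\, r_{q,q}(z,\alpha), \qquad q = \tfrac{1}{2}\big((2m+1)^k-1\big).$$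
   Context: A rational function is of type $(m,\ell)$ if it is a ratio $p(z)/q(z)$ of polynomials (with real coefficients) $p$ and $q$ of degree at most $m$ and $\ell$, respectively; $\mathcal{R}_{m,\ell}$ denotes the set of such functions. For $m \in \mathbb{N}$, $m\ge 1$, $\ell \in \{m-1,m\}$ and $\alpha \in (0,1)$, $r_{m,\ell}(z,\alpha)$ denotes the (unique) rational function $r\in\mathcal{R}_{m,\ell}$ that minimizes $$\max_{z \in [\alpha^2,1]} \left|\frac{r(z)-\sqrt{z}}{\sqrt{z}}\right|$$ over $\mathcal{R}_{m,\ell}$. $\hat{r}_{m,\ell}(z,\alpha)$ denotes the unique scalar multiple of $r_{m,\ell}(z,\alpha)$ with the property that $$\min_{z \in [\alpha^2,1]} \frac{\hat{r}_{m,\ell}(z,\alpha)-\sqrt{z}}{\sqrt{z}} = 0.$$ *)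

theory Defs
  imports Complex_Main
    "HOL-Computational_Algebra.Computational_Algebra"
    "HOL-Computational_Algebra.Field_as_Ring"
    "HOL-Library.Extended_Real"
begin

text \<open>
  Rational functions with real coefficients are elements of the field
  \<open>\<real>(z)\<close> of fractions of real polynomials, so that identities between them do
  not depend on values at poles.
\<close>

type_synonym ratfun = "real poly fract"

definition rf_const :: "real \<Rightarrow> ratfun" where
  "rf_const c = to_fract [:c:]"

text \<open>The identity function \<open>z\<close>.\<close>

definition rf_z :: ratfun where
  "rf_z = to_fract [:0, 1:]"

text \<open>
  \<open>quot_of_fract\<close> returns a coprime numerator and denominator; hence removable
  singularities do not count as poles, and \<open>rf_eval\<close> is the value of the rational
  function everywhere except at its poles.
\<close>

definition rf_pole :: "ratfun \<Rightarrow> real \<Rightarrow> bool" where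
  "rf_pole r z \<longleftrightarrow> poly (snd (quot_of_fract r)) z = 0"

definition rf_eval :: "ratfun \<Rightarrow> real \<Rightarrow> real" where
  "rf_eval r z = poly (fst (quot_of_fract r)) z / poly (snd (quot_of_fract r)) z"

text \<open>
  The composition \<open>r(w(z))\<close>: the numerator and denominator of \<open>r\<close> are evaluated at
  the element \<open>w\<close> of \<open>\<real>(z)\<close>.  The denominator can only vanish for constant \<open>w\<close>;
  in particular never for \<open>w = z / f(z)\<^sup>2\<close> with \<open>f \<noteq> 0\<close>.
\<close>

definition rf_compose :: "ratfun \<Rightarrow> ratfun \<Rightarrow> ratfun" where
  "rf_compose r w =
     poly (map_poly rf_const (fst (quot_of_fract r))) w /
     poly (map_poly rf_const (snd (quot_of_fract r))) w"

definition rat_type :: "nat \<Rightarrow> nat \<Rightarrow> ratfun set" where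
  "rat_type m l = {Fract p q | p q. q \<noteq> 0 \<and> degree p \<le> m \<and> degree q \<le> l}"

definition sqrt_rel_err :: "ratfun \<Rightarrow> real \<Rightarrow> real" where
  "sqrt_rel_err r z = (rf_eval r z - sqrt z) / sqrt z"

text \<open>
  The maximal relative error on \<open>[a\<^sup>2, 1]\<close>, infinite if \<open>r\<close> has a pole there.  For
  \<open>0 < a < 1\<close> the supremum is attained.
\<close>

definition sqrt_max_err :: "real \<Rightarrow> ratfun \<Rightarrow> ereal" where
  "sqrt_max_err a r =
     (SUP z\<in>{a\<^sup>2..1}. if rf_pole r z then \<infinity> else ereal \<bar>sqrt_rel_err r z\<bar>)"

definition zolo_r :: "nat \<Rightarrow> nat \<Rightarrow> real \<Rightarrow> ratfun" where
  "zolo_r m l a = (THE r. is_arg_min (sqrt_max_err a) (\<lambda>s. s \<in> rat_type m l) r)"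

definition zolo_rhat :: "nat \<Rightarrow> nat \<Rightarrow> real \<Rightarrow> ratfun" where
  "zolo_rhat m l a =
     (THE s. (\<exists>c. s = rf_const c * zolo_r m l a) \<and>
             (\<forall>z\<in>{a\<^sup>2..1}. 0 \<le> sqrt_rel_err s z) \<and>
             (\<exists>z\<in>{a\<^sup>2..1}. sqrt_rel_err s z = 0))"

end

theory Submission
  imports Defs "HOL-Analysis.Function_Topology"
begin

text \<open>
  Substituting \<open>z = x\<^sup>2\<close> and passing from \<open>r\<close> to \<open>G(x) = x / r(x\<^sup>2)\<close> makes the theorem a
  statement about iterated composition.  The relative error of \<open>r\<close> at \<open>x\<^sup>2\<close> is \<open>1 / G(x) - 1\<close>, and
  for \<open>w = z / f(z)\<^sup>2\<close> the recursion \<open>f(z) * r(w)\<close> replaces the function \<open>G\<close> of \<open>f\<close> by its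
  composition with the function \<open>G\<close> of \<open>r\<close>.  The functions \<open>G\<close> are odd rational functions of some
  degree \<open>n\<close>, and \<open>n\<close> alone encodes the type: \<open>r\<close> has type \<open>(n div 2, (n - 1) div 2)\<close>, which is
  \<open>(m, m - 1)\<close> for \<open>n = 2 * m\<close> and \<open>(m, m)\<close> for \<open>n = 2 * m + 1\<close>.  Degrees multiply under
  composition, hence the powers \<open>(2 * m)\<^sup>k\<close> and \<open>(2 * m + 1)\<^sup>k\<close>, and both parts of the theorem are
  the same statement about \<open>N = 2 * m\<close> and \<open>N = 2 * m + 1\<close>.

  The property that carries the induction is \<open>equioscillating n a b\<close>: on \<open>[a, 1]\<close> the function \<open>G\<close>
  has values in \<open>[b, 1]\<close>, and it runs \<open>n\<close> times from one of the values \<open>b\<close> and \<open>1\<close> to the other,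
  starting with \<open>G(a) = b\<close>.  Three facts about it give the theorem.

  First, it determines the extremal functions.  A function of type \<open>(n div 2, (n - 1) div 2)\<close> whose
  error is at most that of a suitable multiple of \<open>r\<close> differs from this multiple by a quotient whose
  numerator has degree below \<open>n\<close> and alternates weakly in sign at \<open>n + 1\<close> points, so the two agree
  (\<open>best_approximation_unique\<close>).  Hence \<open>r\<close> is the scaled extremal function, and the factor
  \<open>2 * b / (1 + b)\<close> that balances the errors at \<open>G = b\<close> and \<open>G = 1\<close> turns it into the best
  approximation.

  Secondly, it is preserved: if \<open>G\<close> runs \<open>n\<close> times through \<open>[b, 1]\<close> and \<open>H\<close> oscillates \<open>m\<close> times on
  \<open>[b, 1]\<close>, then \<open>H \<circ> G\<close> oscillates \<open>n * m\<close> times (\<open>equioscillating_compose\<close>).  The value at the left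
  endpoint shows that the new parameter is the number computed by the recursion for \<open>a\<close>.

  Thirdly, for all \<open>n \<ge> 1\<close> and \<open>0 < a < 1\<close> there are \<open>b\<close> and \<open>r\<close> with this property
  (\<open>equioscillating_exists\<close>).  Elliptic functions are avoided by a variational argument for
  Zolotarev's third problem: among the products \<open>B(x) = (\<Prod>i=1..n. (c i - x) / (c i + x))\<close> with all
  \<open>c i\<close> in \<open>[a, 1]\<close>, compactness yields one with the smallest maximum of \<open>\<bar>B\<bar>\<close> on \<open>[a, 1]\<close>.  This
  maximum is attained between any two neighbouring zeros, since otherwise moving the two apart
  would lower \<open>\<bar>B\<bar>\<close> everywhere else (\<open>interior_gap_attains\<close>).  So \<open>B\<close> alternates at \<open>n + 1\<close> points, and
  \<open>G\<close> is a multiple of the Cayley transform \<open>(1 - B) / (1 + B)\<close>, which is odd because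
  \<open>B(- x) = 1 / B(x)\<close>.
\<close>

section \<open>Values of rational functions\<close>

text \<open>
  Absence of a pole and the value are kept together, because only then does the value respect the
  field operations.
\<close>

definition has_rf_value :: "ratfun \<Rightarrow> real \<Rightarrow> real \<Rightarrow> bool" where
  "has_rf_value r z v \<longleftrightarrow> \<not> rf_pole r z \<and> rf_eval r z = v"

lemma coprime_poly_no_common_root:
  fixes a b :: "real poly"
  assumes "coprime a b" "poly a z = 0"
  shows "poly b z \<noteq> 0"
proof
  assume "poly b z = 0"
  with assms(2) have "[:-z, 1:] dvd a" "[:-z, 1:] dvd b"
    by (simp_all add: poly_eq_0_iff_dvd)
  then have "is_unit [:-z, 1:]"
    using assms(1) coprime_common_divisor by blast
  then show False
    by (simp add: is_unit_poly_iff)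
qed

lemma Fract_quot_unique:
  fixes p q :: "real poly"
  assumes "q \<noteq> 0"
  shows "fst (quot_of_fract (Fract p q)) * q = p * snd (quot_of_fract (Fract p q))"
proof -
  let ?a = "fst (quot_of_fract (Fract p q))" and ?b = "snd (quot_of_fract (Fract p q))"
  have "Fract ?a ?b = Fract p q" by (rule Fract_quot_of_fract)
  with assms show ?thesis by (subst (asm) eq_fract) auto
qed

text \<open>
  Any representation whose denominator does not vanish at the point may be used in place of the
  reduced one: the reduced denominator cannot vanish there, as the reduced numerator would
  then vanish too.
\<close>

lemma has_rf_value_Fract:
  assumes "poly q z \<noteq> 0"
  shows "has_rf_value (Fract p q) z (poly p z / poly q z)"
proof -
  define a b where "a = fst (quot_of_fract (Fract p q))" "b = snd (quot_of_fract (Fract p q))"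
  have q0: "q \<noteq> 0" using assms by auto
  have e: "a * q = p * b" unfolding a_b_def by (rule Fract_quot_unique[OF q0])
  have ez: "poly a z * poly q z = poly p z * poly b z"
    using arg_cong[OF e, of "\<lambda>r. poly r z"] by simp
  have cop: "coprime a b" unfolding a_b_def by (rule coprime_quot_of_fract)
  have bz: "poly b z \<noteq> 0"
  proof
    assume b0: "poly b z = 0"
    with ez assms have "poly a z = 0" by simp
    with b0 show False using coprime_poly_no_common_root[OF cop] by blast
  qed
  show ?thesis using ez bz assms
    by (simp add: has_rf_value_def rf_pole_def rf_eval_def a_b_def[symmetric] field_simps)
qed

lemma has_rf_value_unique: "has_rf_value r z v \<Longrightarrow> has_rf_value r z w \<Longrightarrow> v = w"
  by (simp add: has_rf_value_def)

lemma has_rf_valueE: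
  assumes "has_rf_value r z v"
  obtains p q where "r = Fract p q" "poly q z \<noteq> 0" "v = poly p z / poly q z"
  using that[of "fst (quot_of_fract r)" "snd (quot_of_fract r)"] assms
  by (auto simp: has_rf_value_def rf_pole_def rf_eval_def)

lemma has_rf_value_const: "has_rf_value (rf_const c) z c"
  using has_rf_value_Fract[of 1 z "[:c:]"] by (simp add: rf_const_def to_fract_def)

lemma has_rf_value_z: "has_rf_value rf_z z z"
  using has_rf_value_Fract[of 1 z "[:0,1:]"] by (simp add: rf_z_def to_fract_def)

lemma has_rf_value_add:
  assumes "has_rf_value r z v" "has_rf_value s z w"
  shows "has_rf_value (r + s) z (v + w)"
proof -
  obtain p q where 1: "r = Fract p q" "poly q z \<noteq> 0" "v = poly p z / poly q z"
    using assms(1) by (rule has_rf_valueE)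
  obtain p' q' where 2: "s = Fract p' q'" "poly q' z \<noteq> 0" "w = poly p' z / poly q' z"
    using assms(2) by (rule has_rf_valueE)
  have "q \<noteq> 0" "q' \<noteq> 0" using 1 2 by auto
  then show ?thesis
    using has_rf_value_Fract[of "q * q'" z "p * q' + p' * q"] 1 2
    by (simp add: add_frac_eq)
qed

lemma has_rf_value_mult:
  assumes "has_rf_value r z v" "has_rf_value s z w"
  shows "has_rf_value (r * s) z (v * w)"
proof -
  obtain p q where 1: "r = Fract p q" "poly q z \<noteq> 0" "v = poly p z / poly q z"
    using assms(1) by (rule has_rf_valueE)
  obtain p' q' where 2: "s = Fract p' q'" "poly q' z \<noteq> 0" "w = poly p' z / poly q' z"
    using assms(2) by (rule has_rf_valueE)
  show ?thesis
    using has_rf_value_Fract[of "q * q'" z "p * p'"] 1 2 by simp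
qed

lemma has_rf_value_divide:
  assumes "has_rf_value r z v" "has_rf_value s z w" "w \<noteq> 0"
  shows "has_rf_value (r / s) z (v / w)"
proof -
  obtain p q where 1: "r = Fract p q" "poly q z \<noteq> 0" "v = poly p z / poly q z"
    using assms(1) by (rule has_rf_valueE)
  obtain p' q' where 2: "s = Fract p' q'" "poly q' z \<noteq> 0" "w = poly p' z / poly q' z"
    using assms(2) by (rule has_rf_valueE)
  show ?thesis
    using has_rf_value_Fract[of "q * p'" z "p * q'"] 1 2 assms(3) by simp
qed

lemma has_rf_value_nonzero: "has_rf_value r z v \<Longrightarrow> v \<noteq> 0 \<Longrightarrow> r \<noteq> 0"
  using has_rf_value_unique[OF has_rf_value_const[of 0 z]] by (auto simp: rf_const_def)

lemma rf_const_mult: "rf_const (c * d) = rf_const c * rf_const d"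
  by (simp add: rf_const_def flip: to_fract_mult)

lemma rf_const_0 [simp]: "rf_const 0 = 0" by (simp add: rf_const_def)
lemma rf_const_1 [simp]: "rf_const 1 = 1"
  by (simp add: rf_const_def to_fract_def One_fract_def one_pCons)

lemma has_rf_value_poly:
  assumes "has_rf_value w z v"
  shows "has_rf_value (poly (map_poly rf_const p) w) z (poly p v)"
proof (induction p)
  case 0
  show ?case using has_rf_value_const[of 0 z] by simp
next
  case (pCons a p)
  have "has_rf_value (rf_const a + w * poly (map_poly rf_const p) w) z (a + v * poly p v)"
    by (intro has_rf_value_add has_rf_value_const has_rf_value_mult assms pCons.IH)
  then show ?case by (simp add: map_poly_pCons)
qed

lemma has_rf_value_compose:
  assumes "has_rf_value w z v" "has_rf_value r v u"
  shows "has_rf_value (rf_compose r w) z u"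
proof -
  have "poly (snd (quot_of_fract r)) v \<noteq> 0"
    and u: "u = poly (fst (quot_of_fract r)) v / poly (snd (quot_of_fract r)) v"
    using assms(2) by (auto simp: has_rf_value_def rf_pole_def rf_eval_def)
  then show ?thesis unfolding rf_compose_def u
    by (intro has_rf_value_divide has_rf_value_poly assms)
qed

lemma rat_type_degrees:
  assumes "r \<in> rat_type m l"
  shows "degree (fst (quot_of_fract r)) \<le> m" "degree (snd (quot_of_fract r)) \<le> l"
proof -
  obtain p q where r: "r = Fract p q" "q \<noteq> 0" "degree p \<le> m" "degree q \<le> l"
    using assms by (auto simp: rat_type_def)
  define a b where "a = fst (quot_of_fract r)" "b = snd (quot_of_fract r)"
  have e: "a * q = p * b" unfolding a_b_def r(1) by (rule Fract_quot_unique[OF r(2)])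
  have cop: "coprime a b" unfolding a_b_def by (rule coprime_quot_of_fract)
  have b0: "b \<noteq> 0" by (simp add: a_b_def)
  have "b dvd a * q" using e by simp
  then have "b dvd q" using cop coprime_dvd_mult_right_iff[of b a q] by (simp add: coprime_commute)
  then obtain d where d: "q = b * d" by blast
  have "b * (a * d) = b * p" using e d by (simp add: ac_simps)
  then have p: "p = a * d" using b0 by simp
  have d0: "d \<noteq> 0" using d r(2) by auto
  have "degree b \<le> degree q" unfolding d using b0 d0 by (simp add: degree_mult_eq)
  moreover have "degree a \<le> degree p" unfolding p using d0
    by (cases "a = 0") (simp_all add: degree_mult_eq)
  ultimately show "degree (fst (quot_of_fract r)) \<le> m" "degree (snd (quot_of_fract r)) \<le> l"
    using r by (simp_all add: a_b_def)
qed

lemma rat_type_const_mult: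
  assumes "g \<in> rat_type m l"
  shows "rf_const c * g \<in> rat_type m l"
proof -
  obtain p q where g: "g = Fract p q" "q \<noteq> 0" "degree p \<le> m" "degree q \<le> l"
    using assms by (auto simp: rat_type_def)
  have "rf_const c * g = Fract (smult c p) q"
    by (simp add: g(1) rf_const_def to_fract_def)
  moreover have "degree (smult c p) \<le> m" using g(3) degree_smult_le order_trans by blast
  ultimately show ?thesis using g(2,4) unfolding rat_type_def by blast
qed

text \<open>
  Multiplying \<open>P(u / v)\<close> by \<open>v ^ k\<close> clears all denominators; this bounds the degree of a
  composition.
\<close>

lemma homogenise:
  fixes u v :: "real poly"
  assumes v: "v \<noteq> 0" and deg: "degree u \<le> N" "degree v \<le> N" and P: "degree P \<le> k"
  shows "\<exists>h. degree h \<le> k * N \<and>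
    to_fract h = to_fract v ^ k * poly (map_poly rf_const P) (Fract u v)"
  using P
proof (induction k arbitrary: P)
  case 0
  then obtain c where "P = [:c:]" by (metis degree_0_id le_zero_eq)
  then show ?case by (intro exI[of _ "[:c:]"]) (simp add: map_poly_pCons rf_const_def)
next
  case (Suc k)
  obtain c Q where P: "P = pCons c Q" by (cases P)
  have "degree Q \<le> k" using Suc.prems unfolding P by (cases "Q = 0") (auto simp: degree_pCons_eq)
  then obtain h where h: "degree h \<le> k * N"
      "to_fract h = to_fract v ^ k * poly (map_poly rf_const Q) (Fract u v)"
    using Suc.IH by blast
  let ?h = "smult c (v ^ Suc k) + u * h"
  have "degree (smult c (v ^ Suc k)) \<le> Suc k * N"
    using degree_power_le[of v "Suc k"] deg(2)
    by (intro order_trans[OF degree_smult_le]) (metis mult.commute mult_le_mono1 order_trans)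
  moreover have "degree (u * h) \<le> Suc k * N"
    using degree_mult_le[of u h] deg(1) h(1) by simp
  ultimately have "degree ?h \<le> Suc k * N" by (intro degree_add_le)
  moreover have "to_fract ?h = to_fract v ^ Suc k * poly (map_poly rf_const P) (Fract u v)"
  proof -
    define w where "w = Fract u v"
    have uw: "to_fract u = to_fract v * w"
      using v by (simp add: w_def Fract_conv_to_fract)
    have pw: "to_fract (v ^ j) = to_fract v ^ j" for j by (induction j) simp_all
    have sm: "to_fract (smult c p) = rf_const c * to_fract p" for p
      by (simp add: rf_const_def flip: to_fract_mult)
    have "to_fract ?h = rf_const c * to_fract v ^ Suc k + to_fract v * w * (to_fract v ^ k * poly (map_poly rf_const Q) w)"
      by (simp only: to_fract_add sm pw to_fract_mult uw h(2) w_def)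
    also have "\<dots> = to_fract v ^ Suc k * (rf_const c + w * poly (map_poly rf_const Q) w)"
      by (simp add: algebra_simps)
    also have "\<dots> = to_fract v ^ Suc k * poly (map_poly rf_const P) (Fract u v)"
      by (simp add: P map_poly_pCons w_def)
    finally show ?thesis .
  qed
  ultimately show ?case by blast
qed

text \<open>
  With \<open>f = p / q\<close> the inner function is \<open>z q\<^sup>2 / p\<^sup>2\<close>, whose numerator and denominator have degree at
  most \<open>n\<close>.  For odd \<open>m\<close> the powers of \<open>p\<^sup>2\<close> that homogenise the numerator and denominator of \<open>g\<close>
  cancel.  For even \<open>m\<close> one factor \<open>p\<^sup>2\<close> remains in the denominator, and the outer factor \<open>p\<close> cancels
  half of it.
\<close>

lemma rat_type_compose:
  assumes f: "f \<in> rat_type (n div 2) ((n - 1) div 2)" and g: "g \<in> rat_type (m div 2) ((m - 1) div 2)"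
    and n: "1 \<le> n" and m: "1 \<le> m" and f0: "f \<noteq> 0"
    and den: "poly (map_poly rf_const (snd (quot_of_fract g))) (rf_z / f\<^sup>2) \<noteq> 0"
  shows "f * rf_compose g (rf_z / f\<^sup>2) \<in> rat_type (n * m div 2) ((n * m - 1) div 2)"
proof -
  obtain p q where fpq: "f = Fract p q" "q \<noteq> 0" and p: "degree p \<le> n div 2" and q: "degree q \<le> (n - 1) div 2"
    using f by (auto simp: rat_type_def)
  have p0: "p \<noteq> 0" using f0 fpq by (auto simp: fract_collapse)
  define u v where "u = [:0, 1:] * q\<^sup>2" and "v = p\<^sup>2"
  have w: "rf_z / f\<^sup>2 = Fract u v"
    by (simp add: fpq rf_z_def to_fract_def u_def v_def power2_eq_square)
  have v0: "v \<noteq> 0" using p0 by (simp add: v_def)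
  have "degree u \<le> 1 + 2 * ((n - 1) div 2)"
    unfolding u_def using degree_mult_le[of "[:0, 1:]" "q\<^sup>2"] degree_power_le[of q 2] q by simp
  then have du: "degree u \<le> n" using n by linarith
  have "degree v \<le> 2 * (n div 2)" unfolding v_def using degree_power_le[of p 2] p by simp
  then have dv: "degree v \<le> n" by linarith
  define A B where "A = fst (quot_of_fract g)" and "B = snd (quot_of_fract g)"
  define k l where "k = m div 2" and "l = (m - 1) div 2"
  define a b where "a = poly (map_poly rf_const A) (Fract u v)" and "b = poly (map_poly rf_const B) (Fract u v)"
  have dA: "degree A \<le> k" and dB: "degree B \<le> l"
    using rat_type_degrees[OF g] by (simp_all add: A_def B_def k_def l_def)
  obtain hA where hA: "degree hA \<le> k * n" "to_fract hA = to_fract v ^ k * a"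
    using homogenise[OF v0 du dv dA] unfolding a_def by blast
  obtain hB where hB: "degree hB \<le> l * n" "to_fract hB = to_fract v ^ l * b"
    using homogenise[OF v0 du dv dB] unfolding b_def by blast
  have b0: "b \<noteq> 0" using den unfolding w b_def B_def .
  have tv: "to_fract v \<noteq> 0" "to_fract p \<noteq> 0" "to_fract q \<noteq> 0" using v0 p0 fpq by simp_all
  have "to_fract hB \<noteq> 0" using hB(2) b0 tv by simp
  then have hB0: "hB \<noteq> 0" by simp
  have comp: "f * rf_compose g (rf_z / f\<^sup>2) = to_fract p / to_fract q * (a / b)"
    unfolding rf_compose_def w a_def b_def A_def B_def by (simp add: fpq Fract_conv_to_fract)
  show ?thesis
  proof (cases "odd m")
    case True
    then obtain i where i: "m = 2 * i + 1" by (elim oddE)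
    then have kl: "k = i" "l = i" by (simp_all add: k_def l_def)
    have "f * rf_compose g (rf_z / f\<^sup>2) = Fract (p * hA) (q * hB)"
      unfolding comp using hA(2) hB(2) tv b0 by (simp add: Fract_conv_to_fract kl)
    moreover have "degree (p * hA) \<le> n * m div 2"
    proof -
      have "n * m = n + 2 * (i * n)" by (simp add: i algebra_simps)
      then have "n * m div 2 = n div 2 + i * n" by simp
      then show ?thesis using degree_mult_le[of p hA] p hA(1) by (simp add: kl)
    qed
    moreover have "degree (q * hB) \<le> (n * m - 1) div 2"
    proof -
      have "n * m - 1 = (n - 1) + 2 * (i * n)" using n by (simp add: i algebra_simps)
      then have "(n * m - 1) div 2 = (n - 1) div 2 + i * n" by simp
      then show ?thesis using degree_mult_le[of q hB] q hB(1) by (simp add: kl)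
    qed
    moreover have "q * hB \<noteq> 0" using fpq(2) hB0 by simp
    ultimately show ?thesis unfolding rat_type_def by blast
  next
    case False
    then obtain i where i: "m = 2 * Suc i" using m by (metis dvdE mult_0_right not0_implies_Suc not_one_le_zero)
    then have kl: "k = Suc i" "l = i" by (simp_all add: k_def l_def)
    have "to_fract hA = to_fract p * to_fract p * (to_fract v ^ i * a)"
      using hA(2) by (simp add: kl v_def power2_eq_square)
    then have "f * rf_compose g (rf_z / f\<^sup>2) = Fract hA (q * p * hB)"
      unfolding comp using hB(2) tv b0 by (simp add: Fract_conv_to_fract kl)
    moreover have "degree hA \<le> n * m div 2" using hA(1) by (simp add: kl i algebra_simps)
    moreover have "degree (q * p * hB) \<le> (n * m - 1) div 2"
    proof -
      have "n * m - 1 = (n - 1) * 2 + 1 + 2 * (i * n)" using n by (simp add: i algebra_simps)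
      then have "(n * m - 1) div 2 = (n - 1) + i * n" by simp
      moreover have "(n - 1) div 2 + n div 2 = n - 1" using n by linarith
      ultimately show ?thesis
        using degree_mult_le[of "q * p" hB] degree_mult_le[of q p] p q hB(1) unfolding kl by linarith
    qed
    moreover have "q * p * hB \<noteq> 0" using fpq(2) p0 hB0 by simp
    ultimately show ?thesis unfolding rat_type_def by blast
  qed
qed

section \<open>Equioscillation\<close>

text \<open>
  For \<open>g = r\<close> this is the function \<open>G\<close> of the introduction.  Composition acts on these functions, and not on the
  rational functions \<open>g\<close> themselves.
\<close>

definition sqrt_ratio :: "ratfun \<Rightarrow> real \<Rightarrow> real" where
  "sqrt_ratio g x = x / rf_eval g (x\<^sup>2)"

text \<open>
  Since \<open>y\<close> increases strictly from \<open>a\<close> to \<open>1\<close>, the case \<open>n = 0\<close> is excluded when \<open>a < 1\<close>.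
  Both endpoints belong to the alternation: the left one makes \<open>b\<close> the value of \<open>G\<close> at \<open>a\<close>, and
  together they make the oscillations of consecutive pieces of a composition fit.
\<close>

definition equioscillating :: "nat \<Rightarrow> real \<Rightarrow> real \<Rightarrow> ratfun \<Rightarrow> bool" where
  "equioscillating n a b g \<longleftrightarrow>
     g \<in> rat_type (n div 2) ((n - 1) div 2) \<and>
     (\<forall>x\<in>{a..1}. \<not> rf_pole g (x\<^sup>2) \<and> sqrt_ratio g x \<in> {b..1}) \<and>
     (\<exists>y. strict_mono_on {..n} y \<and> y 0 = a \<and> y n = 1 \<and>
          (\<forall>j\<le>n. sqrt_ratio g (y j) = (if even j then b else 1)))"

lemma equioscillatingD:
  assumes "equioscillating n a b g" "0 < a" "0 < b" "x \<in> {a..1}"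
  shows "has_rf_value g (x\<^sup>2) (x / sqrt_ratio g x)" "b \<le> sqrt_ratio g x" "sqrt_ratio g x \<le> 1"
proof -
  have b: "b \<le> sqrt_ratio g x" "sqrt_ratio g x \<le> 1" and np: "\<not> rf_pole g (x\<^sup>2)"
    using assms(1,4) by (auto simp: equioscillating_def)
  then have "rf_eval g (x\<^sup>2) \<noteq> 0" using assms(3) by (auto simp: sqrt_ratio_def)
  then show "has_rf_value g (x\<^sup>2) (x / sqrt_ratio g x)"
    using np assms(2,4) by (simp add: has_rf_value_def sqrt_ratio_def)
  show "b \<le> sqrt_ratio g x" "sqrt_ratio g x \<le> 1" by fact+
qed

lemma strict_mono_on_atMostI:
  fixes y :: "nat \<Rightarrow> real"
  assumes "\<And>j. j < n \<Longrightarrow> y j < y (Suc j)"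
  shows "strict_mono_on {..n} y"
proof (rule strict_mono_onI)
  fix i j assume "i \<in> {..n}" "j \<in> {..n}" "i < j"
  then show "y i < y j"
  proof (induction j)
    case (Suc j)
    then show ?case using assms[of j] by (cases "i = j") (auto intro: less_trans)
  qed simp
qed

section \<open>Equioscillation characterises best approximation\<close>

text \<open>
  The sum is the coefficient of \<open>x ^ n\<close> in the Lagrange interpolation polynomial of \<open>D\<close> at \<open>n + 1\<close>
  points, and this polynomial is \<open>D\<close> itself.
\<close>

lemma divided_difference_low_degree:
  fixes D :: "real poly" and z :: "nat \<Rightarrow> real"
  assumes inj: "inj_on z {..n}" and deg: "degree D < n"
  shows "(\<Sum>j\<le>n. poly D (z j) / (\<Prod>i\<in>{..n} - {j}. z j - z i)) = 0"
proof -
  define L where "L = (\<Sum>j\<le>n. smult (poly D (z j) / (\<Prod>i\<in>{..n} - {j}. z j - z i))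
                         (\<Prod>i\<in>{..n} - {j}. [:- z i, 1:]))"
  have degP: "degree (\<Prod>i\<in>{..n} - {j}. [:- z i, 1:]) = n" if "j \<le> n" for j
    using that by (subst degree_prod_sum_eq) auto
  have monP: "lead_coeff (\<Prod>i\<in>{..n} - {j}. [:- z i, 1:]) = 1" for j
    by (subst lead_coeff_prod) simp
  have degL: "degree L \<le> n"
    unfolding L_def by (rule degree_sum_le) (use degP in \<open>auto intro!: order_trans[OF degree_smult_le]\<close>)
  have val: "poly L (z k) = poly D (z k)" if k: "k \<le> n" for k
  proof -
    have nz: "(\<Prod>i\<in>{..n} - {k}. z k - z i) \<noteq> 0"
      using inj k by (auto simp: prod_zero_iff inj_on_def)
    have "poly L (z k) = (\<Sum>j\<le>n. if j = k then poly D (z k) else 0)"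
      unfolding L_def poly_sum poly_smult poly_prod
    proof (rule sum.cong[OF refl])
      fix j assume j: "j \<in> {..n}"
      have "(\<Prod>i\<in>{..n} - {j}. poly [:- z i, 1:] (z k)) = 0" if "j \<noteq> k"
        using that k by (intro prod_zero) auto
      then show "poly D (z j) / (\<Prod>i\<in>{..n} - {j}. z j - z i) * (\<Prod>i\<in>{..n} - {j}. poly [:- z i, 1:] (z k))
            = (if j = k then poly D (z k) else 0)"
        using nz by (auto simp: algebra_simps)
    qed
    then show ?thesis using k by simp
  qed
  have "L - D = 0"
  proof (rule ccontr)
    assume ne: "L - D \<noteq> 0"
    have "z ` {..n} \<subseteq> {x. poly (L - D) x = 0}" using val by auto
    then have "card (z ` {..n}) \<le> card {x. poly (L - D) x = 0}"
      using poly_roots_finite[OF ne] card_mono by blast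
    then have "n + 1 \<le> degree (L - D)"
      using card_poly_roots_bound[OF ne] card_image[OF inj] by simp
    moreover have "degree (L - D) \<le> n" using degL deg by (intro degree_diff_le) auto
    ultimately show False by simp
  qed
  then have "coeff L n = 0" using deg by (simp add: coeff_eq_0)
  moreover have "coeff L n = (\<Sum>j\<le>n. poly D (z j) / (\<Prod>i\<in>{..n} - {j}. z j - z i))"
    unfolding L_def coeff_sum coeff_smult
    by (rule sum.cong[OF refl]) (use monP degP in \<open>metis atMost_iff mult.right_neutral\<close>)
  ultimately show ?thesis by simp
qed

lemma sgn_prod_differences:
  fixes z :: "nat \<Rightarrow> real"
  assumes mono: "strict_mono_on {..n} z" and j: "j \<le> n"
  shows "0 < (-1) ^ (n - j) * (\<Prod>i\<in>{..n} - {j}. z j - z i)"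
proof -
  have split: "{..n} - {j} = {..<j} \<union> {j<..n}" using j by auto
  have "(\<Prod>i\<in>{j<..n}. z j - z i) = (\<Prod>i\<in>{j<..n}. -1 * (z i - z j))" by simp
  also have "\<dots> = (-1) ^ (n - j) * (\<Prod>i\<in>{j<..n}. z i - z j)"
    by (subst prod.distrib) simp
  finally have e: "(\<Prod>i\<in>{j<..n}. z j - z i) = (-1) ^ (n - j) * (\<Prod>i\<in>{j<..n}. z i - z j)" .
  have "0 < (\<Prod>i<j. z j - z i)" "0 < (\<Prod>i\<in>{j<..n}. z i - z j)"
    using mono j by (auto intro!: prod_pos simp: strict_mono_on_def)
  moreover have "(-1) ^ (n - j) * (\<Prod>i\<in>{..n} - {j}. z j - z i) =
      (\<Prod>i<j. z j - z i) * (\<Prod>i\<in>{j<..n}. z i - z j)"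
    unfolding split
    by (subst prod.union_disjoint) (auto simp: e simp flip: power_mult_distrib)
  ultimately show ?thesis by simp
qed

text \<open>
  Counting sign changes would have to treat zeros at the points \<open>z j\<close> separately.  In the
  divided difference all summands have the same sign, so that all of them vanish; then \<open>D\<close> has
  more zeros than its degree allows.
\<close>

lemma weakly_alternating_poly_zero:
  fixes D :: "real poly" and z :: "nat \<Rightarrow> real"
  assumes mono: "strict_mono_on {..n} z" and deg: "degree D < n"
    and alt: "\<And>j. j \<le> n \<Longrightarrow> 0 \<le> (-1) ^ j * poly D (z j)"
  shows "D = 0"
proof (rule ccontr)
  assume ne: "D \<noteq> 0"
  have inj: "inj_on z {..n}" using mono by (rule strict_mono_on_imp_inj_on)
  define t where "t j = (-1) ^ n * (poly D (z j) / (\<Prod>i\<in>{..n} - {j}. z j - z i))" for j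
  have t: "0 \<le> t j" if j: "j \<le> n" for j
  proof -
    have sg: "(-1::real) ^ n = (-1) ^ j * (-1) ^ (n - j)" using j by (simp flip: power_add)
    have "t j = ((-1) ^ j * poly D (z j)) / ((-1) ^ (n - j) * (\<Prod>i\<in>{..n} - {j}. z j - z i))"
      unfolding t_def sg by (cases "even (n - j)") auto
    then show ?thesis using alt[OF j] sgn_prod_differences[OF mono j] by simp
  qed
  have "(\<Sum>j\<le>n. t j) = 0"
    unfolding t_def sum_distrib_left[symmetric] using divided_difference_low_degree[OF inj deg]
    by simp
  then have t0: "t j = 0" if "j \<le> n" for j
    using t that by (subst (asm) sum_nonneg_eq_0_iff) auto
  have "z ` {..n} \<subseteq> {x. poly D x = 0}"
  proof clarify
    fix j assume j: "j \<le> n"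
    have "(\<Prod>i\<in>{..n} - {j}. z j - z i) \<noteq> 0" using sgn_prod_differences[OF mono j]
      by (metis less_irrefl mult_zero_right)
    then show "poly D (z j) = 0" using t0[OF j] unfolding t_def by simp
  qed
  then have "card (z ` {..n}) \<le> card {x. poly D x = 0}"
    using poly_roots_finite[OF ne] card_mono by blast
  then show False using card_poly_roots_bound[OF ne] card_image[OF inj] deg by simp
qed

lemma nonvanishing_poly_sign:
  fixes p :: "real poly"
  assumes "\<And>z. z \<in> {u..v} \<Longrightarrow> poly p z \<noteq> 0"
  obtains s where "\<And>z. z \<in> {u..v} \<Longrightarrow> 0 < s * poly p z"
proof -
  have ivt: False if z: "z \<in> {u..v}" "w \<in> {u..v}" "poly p z < 0" "0 < poly p w" for z w
  proof -
    have "z \<noteq> w" using z by auto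
    then consider "z < w" | "w < z" by linarith
    then obtain x where "min z w < x" "x < max z w" "poly p x = 0"
      by cases (use poly_IVT_pos[of z w p] poly_IVT_neg[of w z p] z in auto)
    then show False using assms[of x] z by (auto simp: min_def max_def split: if_splits)
  qed
  show ?thesis
  proof (cases "\<exists>w\<in>{u..v}. 0 < poly p w")
    case True
    then show ?thesis using that[of 1] ivt assms by (metis linorder_neqE_linordered_idom mult_1)
  next
    case False
    then have "0 < -1 * poly p z" if z: "z \<in> {u..v}" for z
      using assms[OF z] z by (force simp: not_less order_le_less)
    then show ?thesis using that by blast
  qed
qed

lemma sqrt_max_err_le_iff:
  "sqrt_max_err a r \<le> ereal e \<longleftrightarrow>
    (\<forall>z\<in>{a\<^sup>2..1}. \<not> rf_pole r z \<and> \<bar>sqrt_rel_err r z\<bar> \<le> e)"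
  unfolding sqrt_max_err_def SUP_le_iff by (auto split: if_splits)

lemma sqrt_points:
  assumes "0 < (a::real)" "z \<in> {a\<^sup>2..1}"
  shows "sqrt z \<in> {a..1}" "(sqrt z)\<^sup>2 = z" "0 < sqrt z"
proof -
  have "0 < a\<^sup>2" using assms by simp
  then have "0 < z" using assms(2) by (metis atLeastAtMost_iff less_le_trans)
  then show "(sqrt z)\<^sup>2 = z" "0 < sqrt z" by auto
  show "sqrt z \<in> {a..1}" using assms by (auto intro: real_le_rsqrt)
qed

lemma square_points:
  assumes "0 < (a::real)" "x \<in> {a..1}"
  shows "x\<^sup>2 \<in> {a\<^sup>2..1}"
  using assms by (auto intro: power_mono power_le_one)

lemma scaled_value:
  assumes "equioscillating n a b g" "0 < a" "0 < b" "x \<in> {a..1}"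
  shows "has_rf_value (rf_const c * g) (x\<^sup>2) (c * (x / sqrt_ratio g x))"
    "sqrt_rel_err (rf_const c * g) (x\<^sup>2) = c / sqrt_ratio g x - 1"
proof -
  show v: "has_rf_value (rf_const c * g) (x\<^sup>2) (c * (x / sqrt_ratio g x))"
    by (intro has_rf_value_mult has_rf_value_const equioscillatingD[OF assms])
  have "0 < x" using assms by auto
  then show "sqrt_rel_err (rf_const c * g) (x\<^sup>2) = c / sqrt_ratio g x - 1"
    using v by (simp add: sqrt_rel_err_def has_rf_value_def field_simps)
qed

lemma scaling_constants:
  assumes "0 < (b::real)"
  shows "2 * b / (1 + b) / b - 1 = (1 - b) / (1 + b)"
    "2 * b / (1 + b) - 1 = - ((1 - b) / (1 + b))"
proof -
  have "2 * b / (1 + b) / b = 2 / (1 + b)" using assms by simp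
  then show "2 * b / (1 + b) / b - 1 = (1 - b) / (1 + b)" using assms by (simp add: field_simps)
  show "2 * b / (1 + b) - 1 = - ((1 - b) / (1 + b))" using assms by (simp add: field_simps)
qed

text \<open>
  The factor maps \<open>G = b\<close> and \<open>G = 1\<close> to errors that differ only in sign; see
  \<open>scaling_constants\<close>.
\<close>

lemma equioscillating_scaled_error:
  assumes g: "equioscillating n a b g" and a: "0 < a" and b: "0 < b"
  shows "sqrt_max_err a (rf_const (2 * b / (1 + b)) * g) \<le> ereal ((1 - b) / (1 + b))"
  unfolding sqrt_max_err_le_iff
proof
  fix z assume z: "z \<in> {a\<^sup>2..1}"
  define x G where "x = sqrt z" and "G = sqrt_ratio g x"
  have x: "x \<in> {a..1}" "x\<^sup>2 = z" using sqrt_points[OF a z] by (auto simp: x_def)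
  have G: "b \<le> G" "G \<le> 1" unfolding G_def using equioscillatingD[OF g a b x(1)] by auto
  have "2 * b / (1 + b) / G \<le> 2 * b / (1 + b) / b" "2 * b / (1 + b) / 1 \<le> 2 * b / (1 + b) / G"
    using G b by (intro divide_left_mono; simp)+
  with scaling_constants[OF b] have "\<bar>2 * b / (1 + b) / G - 1\<bar> \<le> (1 - b) / (1 + b)" by linarith
  then show "\<not> rf_pole (rf_const (2 * b / (1 + b)) * g) z \<and>
      \<bar>sqrt_rel_err (rf_const (2 * b / (1 + b)) * g) z\<bar> \<le> (1 - b) / (1 + b)"
    using scaled_value[OF g a b x(1), of "2 * b / (1 + b)"] x(2)
    by (auto simp: has_rf_value_def G_def)
qed

text \<open>
  The scaled \<open>g\<close> attains the errors \<open>\<plusminus> (1 - b) / (1 + b)\<close> alternately, so the difference to a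
  competitor \<open>t\<close> that is no worse has weakly alternating signs.  Denominators have constant sign
  on the interval, so the numerator of the difference alternates as well, and
  \<open>weakly_alternating_poly_zero\<close> applies.
\<close>

lemma best_approximation_unique:
  assumes g: "equioscillating n a b g" and a: "0 < a" "a < 1" and b: "0 < b"
    and t: "t \<in> rat_type (n div 2) ((n - 1) div 2)"
    and err: "sqrt_max_err a t \<le> ereal ((1 - b) / (1 + b))"
  shows "t = rf_const (2 * b / (1 + b)) * g"
proof -
  define c where "c = 2 * b / (1 + b)"
  define r where "r = rf_const c * g"
  define A B where "A = fst (quot_of_fract r)" "B = snd (quot_of_fract r)"
  define p q where "p = fst (quot_of_fract t)" "q = snd (quot_of_fract t)"
  obtain y where y: "strict_mono_on {..n} y" "y 0 = a" "y n = 1"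
    and osc: "\<And>j. j \<le> n \<Longrightarrow> sqrt_ratio g (y j) = (if even j then b else 1)"
    using g by (auto simp: equioscillating_def)
  have n: "n \<noteq> 0" using y a by (metis less_irrefl)
  have yin: "y j \<in> {a..1}" if "j \<le> n" for j
    using strict_mono_on_leD[OF y(1), of 0 j] strict_mono_on_leD[OF y(1), of j n] that y by auto
  have r: "r \<in> rat_type (n div 2) ((n - 1) div 2)"
    unfolding r_def using g by (intro rat_type_const_mult) (simp add: equioscillating_def)
  have Bq: "poly (B * q) z \<noteq> 0" if z: "z \<in> {a\<^sup>2..1}" for z
  proof -
    have "\<not> rf_pole r z"
      using scaled_value(1)[OF g a(1) b sqrt_points(1)[OF a(1) z], of c] sqrt_points(2)[OF a(1) z]
      by (simp add: r_def has_rf_value_def)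
    moreover have "\<not> rf_pole t z" using err z by (auto simp: sqrt_max_err_le_iff)
    ultimately show ?thesis by (simp add: rf_pole_def A_B_def p_q_def)
  qed
  obtain s where s: "\<And>z. z \<in> {a\<^sup>2..1} \<Longrightarrow> 0 < s * poly (B * q) z"
    using nonvanishing_poly_sign[of "a\<^sup>2" 1 "B * q"] Bq by blast
  define D where "D = smult s (A * q - p * B)"
  have alt: "0 \<le> (-1) ^ j * poly D ((y j)\<^sup>2)" if j: "j \<le> n" for j
  proof -
    let ?x = "y j" and ?z = "(y j)\<^sup>2"
    have x: "?x \<in> {a..1}" "0 < ?x" using yin[OF j] a by auto
    have z: "?z \<in> {a\<^sup>2..1}" by (rule square_points[OF a(1) x(1)])
    have nz: "poly B ?z \<noteq> 0" "poly q ?z \<noteq> 0" using Bq[OF z] by auto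
    have "poly D ?z = s * poly (B * q) ?z * (rf_eval r ?z - rf_eval t ?z)"
      using nz by (simp add: D_def rf_eval_def A_B_def[symmetric] p_q_def[symmetric] field_simps)
    also have "rf_eval r ?z - rf_eval t ?z = ?x * (sqrt_rel_err r ?z - sqrt_rel_err t ?z)"
      using x by (simp add: sqrt_rel_err_def field_simps)
    finally have D: "poly D ?z = (s * poly (B * q) ?z * ?x) * (sqrt_rel_err r ?z - sqrt_rel_err t ?z)"
      by simp
    have pos: "0 < s * poly (B * q) ?z * ?x" using s[OF z] x by simp
    have et: "\<bar>sqrt_rel_err t ?z\<bar> \<le> (1 - b) / (1 + b)"
      using err z by (auto simp: sqrt_max_err_le_iff)
    have er: "sqrt_rel_err r ?z = (if even j then c / b - 1 else c - 1)"
      using scaled_value(2)[OF g a(1) b x(1), of c] osc[OF j] by (simp add: r_def)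
    have c: "c / b - 1 = (1 - b) / (1 + b)" "c - 1 = - ((1 - b) / (1 + b))"
      using scaling_constants[OF b] by (simp_all add: c_def)
    have "0 \<le> (-1) ^ j * (sqrt_rel_err r ?z - sqrt_rel_err t ?z)"
      using et er c by (cases "even j") auto
    then have "0 \<le> (s * poly (B * q) ?z * ?x) * ((-1) ^ j * (sqrt_rel_err r ?z - sqrt_rel_err t ?z))"
      by (rule mult_nonneg_nonneg[OF less_imp_le[OF pos]])
    then show ?thesis unfolding D by (simp only: mult.left_commute[of "(-1) ^ j"])
  qed
  have "strict_mono_on {..n} (\<lambda>j. (y j)\<^sup>2)"
  proof (rule strict_mono_onI)
    fix i j assume ij: "i \<in> {..n}" "j \<in> {..n}" "i < j"
    have "y i < y j" using y(1) ij by (simp add: strict_mono_on_def)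
    moreover have "0 \<le> y i" using yin[of i] ij a by simp
    ultimately show "(y i)\<^sup>2 < (y j)\<^sup>2" by (rule power_strict_mono) simp
  qed
  moreover have "degree D < n"
  proof -
    have "degree (A * q) \<le> n - 1" "degree (p * B) \<le> n - 1"
      using rat_type_degrees[OF r] rat_type_degrees[OF t] n
        degree_mult_le[of A q] degree_mult_le[of p B] by (auto simp: A_B_def p_q_def)
    then have "degree D \<le> n - 1" unfolding D_def
      by (meson degree_diff_le degree_smult_le order_trans)
    then show ?thesis using n by simp
  qed
  ultimately have "D = 0" using weakly_alternating_poly_zero[of n "\<lambda>j. (y j)\<^sup>2" D] alt by blast
  moreover have "s \<noteq> 0" using s[of 1] a by (auto simp: abs_square_le_1 power_le_one)
  ultimately have "A * q = p * B" by (simp add: D_def)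
  then have "Fract A B = Fract p q" by (subst eq_fract) (auto simp: A_B_def p_q_def)
  then show ?thesis unfolding A_B_def p_q_def by (simp add: r_def c_def)
qed

lemma zolo_r_equioscillating:
  assumes g: "equioscillating n a b g" and a: "0 < a" "a < 1" and b: "0 < b"
  shows "zolo_r (n div 2) ((n - 1) div 2) a = rf_const (2 * b / (1 + b)) * g"
  unfolding zolo_r_def
proof (rule the_equality)
  let ?r = "rf_const (2 * b / (1 + b)) * g" and ?P = "\<lambda>s. s \<in> rat_type (n div 2) ((n - 1) div 2)"
  have r: "?P ?r" using g by (intro rat_type_const_mult) (simp add: equioscillating_def)
  have e: "sqrt_max_err a ?r \<le> ereal ((1 - b) / (1 + b))"
    by (rule equioscillating_scaled_error[OF g a(1) b])
  note u = best_approximation_unique[OF g a b]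
  show "is_arg_min (sqrt_max_err a) ?P ?r"
    unfolding is_arg_min_def using r e u by (metis less_imp_le less_irrefl order_trans)
  show "t = ?r" if "is_arg_min (sqrt_max_err a) ?P t" for t
    using that r e u unfolding is_arg_min_def by (meson not_le order_trans)
qed

text \<open>
  A multiple \<open>e * g\<close> has relative error \<open>e / G - 1\<close>.  At the point \<open>y 1\<close>, where \<open>G = 1\<close>, nonnegativity
  forces \<open>e \<ge> 1\<close>; a zero of the error forces \<open>e \<le> 1\<close>, as \<open>G \<le> 1\<close>.
\<close>

lemma zolo_rhat_equioscillating:
  assumes g: "equioscillating n a b g" and a: "0 < a" "a < 1" and b: "0 < b"
  shows "zolo_rhat (n div 2) ((n - 1) div 2) a = g"
  unfolding zolo_rhat_def zolo_r_equioscillating[OF assms]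
proof (rule the_equality)
  let ?c = "2 * b / (1 + b)"
  have c: "?c \<noteq> 0" using b by simp
  obtain y where y: "strict_mono_on {..n} y" "y 0 = a" "y n = 1"
    and osc: "\<And>j. j \<le> n \<Longrightarrow> sqrt_ratio g (y j) = (if even j then b else 1)"
    using g by (auto simp: equioscillating_def)
  have n: "1 \<le> n" using y a by (cases n) auto
  have y1: "y 1 \<in> {a..1}"
    using strict_mono_on_leD[OF y(1), of 0 1] strict_mono_on_leD[OF y(1), of 1 n] n y by auto
  have G1: "sqrt_ratio g (y 1) = 1" using osc[OF n] by simp
  note val = scaled_value[OF g a(1) b]
  note G = equioscillatingD(2,3)[OF g a(1) b]
  have "g = rf_const (1 / ?c) * (rf_const ?c * g)"
    using c by (simp flip: rf_const_mult mult.assoc)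
  moreover have "0 \<le> sqrt_rel_err g z" if z: "z \<in> {a\<^sup>2..1}" for z
    using val(2)[OF sqrt_points(1)[OF a(1) z], of 1] G[OF sqrt_points(1)[OF a(1) z]] b
      sqrt_points(2)[OF a(1) z] by simp
  moreover have "sqrt_rel_err g ((y 1)\<^sup>2) = 0" using val(2)[OF y1, of 1] G1 by simp
  moreover have "(y 1)\<^sup>2 \<in> {a\<^sup>2..1}" by (rule square_points[OF a(1) y1])
  ultimately show "(\<exists>c. g = rf_const c * (rf_const ?c * g)) \<and>
      (\<forall>z\<in>{a\<^sup>2..1}. 0 \<le> sqrt_rel_err g z) \<and> (\<exists>z\<in>{a\<^sup>2..1}. sqrt_rel_err g z = 0)" by blast
  fix s
  assume s: "(\<exists>c. s = rf_const c * (rf_const ?c * g)) \<and>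
      (\<forall>z\<in>{a\<^sup>2..1}. 0 \<le> sqrt_rel_err s z) \<and> (\<exists>z\<in>{a\<^sup>2..1}. sqrt_rel_err s z = 0)"
  then obtain d where "s = rf_const d * (rf_const ?c * g)" by blast
  then have sd: "s = rf_const (d * ?c) * g" by (simp only: rf_const_mult mult.assoc)
  have d1: "1 \<le> d * ?c"
  proof -
    have "0 \<le> sqrt_rel_err s ((y 1)\<^sup>2)" using s square_points[OF a(1) y1] by blast
    also have "\<dots> = d * ?c - 1" using val(2)[OF y1, of "d * ?c"] G1 by (simp only: sd div_by_1)
    finally show ?thesis by simp
  qed
  obtain z where z: "z \<in> {a\<^sup>2..1}" "sqrt_rel_err s z = 0" using s by blast
  have "d * ?c / sqrt_ratio g (sqrt z) = 1"
    using z(2) val(2)[OF sqrt_points(1)[OF a(1) z(1)], of "d * ?c"]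
    unfolding sd sqrt_points(2)[OF a(1) z(1)] by linarith
  then have "d * ?c = sqrt_ratio g (sqrt z)" by (metis divide_eq_1_iff)
  then have "d * ?c \<le> 1" using G[OF sqrt_points(1)[OF a(1) z(1)]] by simp
  with d1 have dc: "d * ?c = 1" by (rule antisym[rotated])
  have "s = rf_const 1 * g" using sd unfolding dc .
  then show "s = g" by (simp only: rf_const_1 mult_1)
qed

section \<open>A minimal Blaschke product\<close>

text \<open>
  For positive \<open>c i\<close> a finite Blaschke product of the right half-plane: it satisfies
  \<open>B(- x) = 1 / B(x)\<close> and is bounded by \<open>1\<close> for \<open>x > 0\<close>.
\<close>

definition blaschke :: "nat \<Rightarrow> (nat \<Rightarrow> real) \<Rightarrow> real \<Rightarrow> real" where
  "blaschke n c x = (\<Prod>i=1..n. (c i - x) / (c i + x))"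

lemma tendsto_blaschke:
  assumes "\<And>i. i \<in> {1..n} \<Longrightarrow> ((\<lambda>k. c k i) \<longlongrightarrow> d i) F" "(x \<longlongrightarrow> y) F"
    and "\<And>i. i \<in> {1..n} \<Longrightarrow> 0 < d i" "0 < y"
  shows "((\<lambda>k. blaschke n (c k) (x k)) \<longlongrightarrow> blaschke n d y) F"
  unfolding blaschke_def
proof (intro tendsto_prod tendsto_divide tendsto_diff tendsto_add assms(1,2))
  fix i assume "i \<in> {1..n}"
  then have "0 < d i + y" by (intro add_pos_pos assms(3,4))
  then show "d i + y \<noteq> 0" by simp
qed

lemma continuous_on_blaschke:
  assumes "\<And>i. i \<in> {1..n} \<Longrightarrow> 0 < c i"
  shows "continuous_on {0<..} (blaschke n c)"
  unfolding blaschke_def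
proof (intro continuous_on_prod continuous_on_divide continuous_intros ballI)
  fix x :: real and j assume "j \<in> {1..n}" "x \<in> {0<..}"
  then have "0 < c j + x" by (intro add_pos_pos assms) auto
  then show "c j + x \<noteq> 0" by simp
qed

lemma compact_unit_box: "compact {c::nat \<Rightarrow> real. \<forall>i. c i \<in> {a..1}}"
proof -
  have "compactin (product_topology (\<lambda>_::nat. euclidean::real topology) UNIV) (PiE UNIV (\<lambda>_. {a..1}))"
    by (simp add: compactin_PiE)
  moreover have "PiE UNIV (\<lambda>_. {a..1}) = {c::nat \<Rightarrow> real. \<forall>i. c i \<in> {a..1}}"
    by (auto simp: PiE_def Pi_def)
  ultimately show ?thesis by (simp add: euclidean_product_topology)
qed

lemma blaschke_cong: "(\<And>i. i \<in> {1..n} \<Longrightarrow> c i = d i) \<Longrightarrow> blaschke n c = blaschke n d"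
  by (simp add: blaschke_def fun_eq_iff)

lemma blaschke_factor_less_1:
  fixes u x :: real
  assumes "0 < u" "0 < x"
  shows "\<bar>(u - x) / (u + x)\<bar> < 1"
  using assms by (auto simp: abs_if field_simps)

text \<open>
  Only \<open>c 1, \<dots>, c n\<close> enter the product, so only these are restricted.  This leaves \<open>c 0\<close> and
  \<open>c (Suc n)\<close> free to serve as the endpoints of the interval.
\<close>

definition minimal_blaschke :: "nat \<Rightarrow> real \<Rightarrow> (nat \<Rightarrow> real) \<Rightarrow> real \<Rightarrow> bool" where
  "minimal_blaschke n a c M \<longleftrightarrow> (\<forall>i\<in>{1..n}. c i \<in> {a..1}) \<and>
     (\<forall>x\<in>{a..1}. \<bar>blaschke n c x\<bar> \<le> M) \<and>
     (\<forall>d. (\<forall>i\<in>{1..n}. d i \<in> {a..1}) \<longrightarrow> (\<exists>x\<in>{a..1}. M \<le> \<bar>blaschke n d x\<bar>))"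

text \<open>
  A sequence of parameters whose maxima approach the infimum has a convergent subsequence, because
  the box of parameters is compact in the product topology.
\<close>

lemma minimal_blaschke_exists:
  assumes a: "0 < a" "a < 1"
  shows "\<exists>c M. minimal_blaschke n a c M"
proof -
  define K where "K = {c::nat \<Rightarrow> real. \<forall>i. c i \<in> {a..1}}"
  define V where "V = {v. \<exists>d\<in>K. \<forall>x\<in>{a..1}. \<bar>blaschke n d x\<bar> \<le> v}"
  define M where "M = Inf V"
  have bdd: "bdd_below V"
  proof (rule bdd_belowI[of _ 0])
    fix v assume "v \<in> V"
    then obtain d where "\<forall>x\<in>{a..1}. \<bar>blaschke n d x\<bar> \<le> v" unfolding V_def by blast
    then have "\<bar>blaschke n d a\<bar> \<le> v" using a by simp
    then show "0 \<le> v" by linarith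
  qed
  have pos: "0 < d i" if "d \<in> K" for d i
  proof -
    have "a \<le> d i" using that by (simp add: K_def)
    with a show ?thesis by linarith
  qed
  have att: "\<exists>x\<in>{a..1}. \<forall>y\<in>{a..1}. \<bar>blaschke n d y\<bar> \<le> \<bar>blaschke n d x\<bar>" if "d \<in> K" for d
  proof (rule continuous_attains_sup)
    have "continuous_on {a..1} (blaschke n d)"
      by (rule continuous_on_subset[OF continuous_on_blaschke]) (use pos[OF that] a in \<open>auto simp: less_le_trans[of 0 a]\<close>)
    then show "continuous_on {a..1} (\<lambda>y. \<bar>blaschke n d y\<bar>)" by (rule continuous_on_rabs)
  qed (use a in auto)
  have aK: "(\<lambda>_. a) \<in> K" using a by (simp add: K_def)
  have V: "V \<noteq> {}" using att[OF aK] aK unfolding V_def by blast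
  have "\<exists>d\<in>K. \<forall>x\<in>{a..1}. \<bar>blaschke n d x\<bar> \<le> M + 1 / real (Suc k)" for k
  proof -
    have "Inf V < M + 1 / real (Suc k)" by (simp add: M_def)
    then obtain v where "v \<in> V" "v < M + 1 / real (Suc k)" using cInf_lessD[OF V] by blast
    then obtain d where "d \<in> K" "\<forall>x\<in>{a..1}. \<bar>blaschke n d x\<bar> \<le> v" unfolding V_def by blast
    then show ?thesis using \<open>v < _\<close> by (intro bexI[of _ d]) force+
  qed
  then obtain d where d: "\<And>k. d k \<in> K" "\<And>k x. x \<in> {a..1} \<Longrightarrow> \<bar>blaschke n (d k) x\<bar> \<le> M + 1 / real (Suc k)"
    by metis
  obtain c r where c: "c \<in> K" "strict_mono r" "(d \<circ> r) \<longlonglongrightarrow> c"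
    using seq_compactE[OF compact_imp_seq_compact[OF compact_unit_box[of a]], folded K_def, of d] d(1)
    by blast
  have lim: "(\<lambda>k. d (r k) i) \<longlonglongrightarrow> c i" for i
    using continuous_on_tendsto_compose[OF continuous_on_product_coordinates[of i] c(3)]
    by (simp add: o_def)
  have cM: "\<bar>blaschke n c x\<bar> \<le> M" if x: "x \<in> {a..1}" for x
  proof (rule LIMSEQ_le)
    show "(\<lambda>k. \<bar>blaschke n (d (r k)) x\<bar>) \<longlonglongrightarrow> \<bar>blaschke n c x\<bar>"
      by (intro tendsto_rabs tendsto_blaschke lim tendsto_const) (use pos[OF c(1)] x a in auto)
    have "(\<lambda>k. M + 1 / real (Suc k)) \<longlonglongrightarrow> M + 0"
      by (intro tendsto_add tendsto_const LIMSEQ_Suc lim_const_over_n)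
    from LIMSEQ_subseq_LIMSEQ[OF this c(2)]
    show "(\<lambda>k. M + 1 / real (Suc (r k))) \<longlonglongrightarrow> M" by (simp add: o_def)
  qed (use d(2)[OF x] in auto)
  have "\<exists>x\<in>{a..1}. M \<le> \<bar>blaschke n d x\<bar>" if "\<forall>i\<in>{1..n}. d i \<in> {a..1}" for d
  proof -
    \<comment> \<open>Parameters outside \<open>{1..n}\<close> are reset, so that \<open>d'\<close> lies in the compact box.\<close>
    define d' where "d' i = (if i \<in> {1..n} then d i else a)" for i
    have d': "d' \<in> K" using that a by (auto simp: K_def d'_def)
    have eq: "blaschke n d' = blaschke n d" by (rule blaschke_cong) (simp add: d'_def)
    obtain x where x: "x \<in> {a..1}" "\<forall>y\<in>{a..1}. \<bar>blaschke n d' y\<bar> \<le> \<bar>blaschke n d' x\<bar>"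
      using att[OF d'] by blast
    then have "\<bar>blaschke n d' x\<bar> \<in> V" using d' unfolding V_def by blast
    then have "M \<le> \<bar>blaschke n d' x\<bar>" unfolding M_def by (rule cInf_lower[OF _ bdd])
    then show ?thesis using x(1) eq by auto
  qed
  moreover have "\<forall>i\<in>{1..n}. c i \<in> {a..1}" using c(1) by (simp add: K_def)
  ultimately show ?thesis using cM unfolding minimal_blaschke_def by blast
qed

text \<open>
  The product does not depend on the order of its factors.  The endpoints of the interval are
  stored at the indices \<open>0\<close> and \<open>Suc n\<close>, so that the \<open>n + 1\<close> gaps between neighbouring zeros, the two
  outer ones included, are the intervals \<open>{c j..c (Suc j)}\<close> with \<open>j \<le> n\<close>.
\<close>

lemma blaschke_sorted:
  assumes "\<And>i. i \<in> {1..n} \<Longrightarrow> c i \<in> {a..1}" "a \<le> 1"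
  obtains d where "mono d" "d 0 = a" "d (Suc n) = 1" "\<And>i. d i \<in> {a..1}" "blaschke n d = blaschke n c"
proof
  define xs where "xs = sort (map c [1..<Suc n])"
  define d where "d i = (if i = 0 then a else if i \<le> n then xs ! (i - 1) else 1)" for i
  have len: "length xs = n" by (simp add: xs_def)
  have set: "set xs \<subseteq> {a..1}" using assms(1) by (auto simp: xs_def)
  then have nth: "xs ! i \<in> {a..1}" if "i < n" for i using nth_mem[of i xs] that len by blast
  show range: "d i \<in> {a..1}" for i
    using nth[of "i - 1"] assms(2) by (auto simp: d_def)
  have srt: "xs ! i \<le> xs ! j" if "i \<le> j" "j < n" for i j
    using that len sorted_nth_mono[of xs i j] by (simp add: xs_def)
  show "mono d"
  proof (rule monoI)
    fix i j :: nat assume ij: "i \<le> j"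
    consider "i = 0" | "n < j" | "0 < i" "j \<le> n" by linarith
    then show "d i \<le> d j"
    proof cases
      case 1 then show ?thesis using range[of j] by (simp add: d_def)
    next
      case 2 then show ?thesis using range[of i] by (simp add: d_def)
    next
      case 3 then show ?thesis using srt[of "i - 1" "j - 1"] ij by (auto simp: d_def)
    qed
  qed
  show "d 0 = a" "d (Suc n) = 1" by (simp_all add: d_def)
  show "blaschke n d = blaschke n c"
  proof
    fix x :: real
    let ?f = "\<lambda>u. (u - x) / (u + x)"
    have "blaschke n d x = (\<Prod>i<n. ?f (d (Suc i)))"
      unfolding blaschke_def One_nat_def by (rule prod.atLeast1_atMost_eq)
    also have "\<dots> = (\<Prod>i<n. ?f (xs ! i))" by (rule prod.cong) (simp_all add: d_def Suc_le_eq)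
    also have "\<dots> = prod_list (map ?f xs)"
      by (simp add: prod.list_conv_set_nth len lessThan_atLeast0)
    also have "\<dots> = prod_list (map ?f (map c [1..<Suc n]))"
      by (simp only: prod_mset_prod_list[symmetric] mset_map xs_def mset_sort)
    also have "\<dots> = blaschke n c x"
      unfolding blaschke_def
      by (simp only: map_map prod.distinct_set_conv_list[symmetric] distinct_upt set_upt)
         (simp add: atLeastLessThanSuc_atLeastAtMost)
    finally show "blaschke n d x = blaschke n c x" .
  qed
qed

text \<open>
  Moving one zero or a pair of zeros is in each case an increase of \<open>S\<close> in a quotient of this form.
\<close>

lemma fraction_strict_antimono:
  fixes X S T :: real
  assumes "0 < S" "S < T" "0 < X"
  shows "(X - T) / (X + T) < (X - S) / (X + S)"
proof -
  have "(X - T) * (X + S) < (X - S) * (X + T)"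
  proof -
    have "X * S < X * T" using assms by simp
    then show ?thesis by (simp add: algebra_simps)
  qed
  then show ?thesis
    using assms by (subst frac_less_eq) (auto simp: divide_neg_pos)
qed

lemma abs_blaschke_factor:
  fixes u x :: real
  assumes "0 < u" "0 < x"
  shows "\<bar>(u - x) / (u + x)\<bar> = \<bar>u - x\<bar> / (u + x)"
  using assms by (simp add: abs_divide)

lemma move_right:
  fixes u x t :: real
  assumes "0 < u" "1 < t" "u * t < x"
  shows "\<bar>(u * t - x) / (u * t + x)\<bar> < \<bar>(u - x) / (u + x)\<bar>"
proof -
  have ut: "u < u * t" using assms by simp
  have x0: "0 < u * t" "u < x" "0 < x" using assms ut by linarith+
  have "\<bar>(u * t - x) / (u * t + x)\<bar> = (x - u * t) / (x + u * t)"
       "\<bar>(u - x) / (u + x)\<bar> = (x - u) / (x + u)"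
    unfolding abs_blaschke_factor[OF x0(1,3)] abs_blaschke_factor[OF assms(1) x0(3)]
    using assms(3) x0(2) by (simp_all add: add.commute)
  moreover have "(x - u * t) / (x + u * t) < (x - u) / (x + u)"
    using assms(1) ut x0 by (intro fraction_strict_antimono)
  ultimately show ?thesis by (simp only:)
qed

lemma move_left:
  fixes u x t :: real
  assumes "0 < x" "1 < t" "x < u / t"
  shows "\<bar>(u / t - x) / (u / t + x)\<bar> < \<bar>(u - x) / (u + x)\<bar>"
proof -
  have xt: "x < x * t" "x * t < u" using assms by (simp_all add: field_simps)
  have cancel: "A / t / (B / t) = A / B" for A B :: real using assms(2) by simp
  have "x * t / t = x" using assms(2) by simp
  then have "u / t - x = (u - x * t) / t" "u / t + x = (u + x * t) / t"
    by (simp_all only: diff_divide_distrib add_divide_distrib)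
  then have "(u / t - x) / (u / t + x) = (u - x * t) / (u + x * t)" by (simp only: cancel)
  moreover have u0: "0 < u" "0 < x * t" using xt assms(1) by linarith+
  moreover have "\<bar>(u - x * t) / (u + x * t)\<bar> = (u - x * t) / (u + x * t)"
       "\<bar>(u - x) / (u + x)\<bar> = (u - x) / (u + x)"
    unfolding abs_blaschke_factor[OF u0] abs_blaschke_factor[OF u0(1) assms(1)]
    using xt by simp_all
  moreover have "(u - x * t) / (u + x * t) < (u - x) / (u + x)"
    using assms(1) xt u0 by (intro fraction_strict_antimono)
  ultimately show ?thesis by (simp only:)
qed

text \<open>
  If \<open>u\<close> and \<open>v\<close> are replaced by \<open>u / t\<close> and \<open>v * t\<close>, then their product, and hence
  \<open>X = x\<^sup>2 + u v\<close>, stays the same, while their sum grows.  The product of the two factors is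
  \<open>(X - (u + v) x) / (X + (u + v) x)\<close>.
\<close>

lemma move_apart:
  fixes u v x t :: real
  assumes "0 < u" "u \<le> v" "1 < t" "0 < x" "x < u / t \<or> v * t < x"
  shows "\<bar>(u / t - x) / (u / t + x) * ((v * t - x) / (v * t + x))\<bar>
       < \<bar>(u - x) / (u + x) * ((v - x) / (v + x))\<bar>"
proof -
  define X S T where "X = x * x + u * v" "S = (u + v) * x" "T = (u / t + v * t) * x"
  have ut: "u / t < u" "v < v * t" using assms by (simp_all add: field_simps)
  have "0 < (t - 1) * (v - u / t)" using ut assms by simp
  moreover have "(t - 1) * (v - u / t) = u / t + v * t - (u + v)"
  proof -
    have "t * (u / t) = u" using assms by simp
    then show ?thesis by (simp only: left_diff_distrib right_diff_distrib) (simp add: algebra_simps)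
  qed
  ultimately have "u + v < u / t + v * t" by simp
  then have S: "0 < S" "S < T" using assms by (simp_all add: X_S_T_def)
  have "0 \<le> (u / t - x) * (v * t - x)"
    using assms(5)
  proof
    assume "x < u / t" then show ?thesis using ut assms(2) by (intro mult_nonneg_nonneg) linarith+
  next
    assume "v * t < x" then show ?thesis using ut assms(2) by (intro mult_nonpos_nonpos) linarith+
  qed
  moreover have new: "(u / t - x) * (v * t - x) = X - T" "(u / t + x) * (v * t + x) = X + T"
    "(u - x) * (v - x) = X - S" "(u + x) * (v + x) = X + S"
    using assms by (simp_all add: X_S_T_def algebra_simps)
  ultimately have T: "T \<le> X" by simp
  have eq: "(u / t - x) / (u / t + x) * ((v * t - x) / (v * t + x)) = (X - T) / (X + T)"
       "(u - x) / (u + x) * ((v - x) / (v + x)) = (X - S) / (X + S)"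
    unfolding times_divide_times_eq new by (rule refl)+
  have nonneg: "0 \<le> (X - T) / (X + T)" using S T by simp
  have less: "(X - T) / (X + T) < (X - S) / (X + S)"
    using S T by (intro fraction_strict_antimono) linarith+
  show ?thesis
    unfolding eq abs_of_nonneg[OF nonneg] abs_of_nonneg[OF order_trans[OF nonneg less_imp_le[OF less]]]
    by (rule less)
qed

text \<open>
  Moving the ends of one gap apart lowers the modulus outside the enlarged gap.  For an outer gap
  only one end is a zero of the product, and changing the other, which is a mere endpoint, has no
  effect.
\<close>

lemma spread_reduces:
  fixes c :: "nat \<Rightarrow> real"
  assumes pos: "\<And>i. 0 < c i" and mono: "mono c" and n: "1 \<le> n" and j: "j \<le> n"
    and t: "1 < t" and x: "0 < x"
    and out: "(1 \<le> j \<and> x < c j / t) \<or> (j < n \<and> c (Suc j) * t < x)"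
  defines "d \<equiv> c(j := c j / t, Suc j := c (Suc j) * t)"
  shows "blaschke n d x = 0 \<or> \<bar>blaschke n d x\<bar> < \<bar>blaschke n c x\<bar>"
proof -
  define f where "f u = (u - x) / (u + x)" for u
  define I where "I = {1..n} \<inter> {j, Suc j}"
  have split: "blaschke n e x = (\<Prod>i\<in>I. f (e i)) * (\<Prod>i\<in>{1..n} - I. f (e i))" for e
    unfolding blaschke_def f_def[symmetric]
    by (subst mult.commute, rule prod.subset_diff) (auto simp: I_def)
  have rest: "(\<Prod>i\<in>{1..n} - I. f (d i)) = (\<Prod>i\<in>{1..n} - I. f (c i))"
    by (rule prod.cong) (auto simp: d_def I_def)
  have "c j \<le> c (Suc j)" using mono by (simp add: monoD)
  consider "j = 0" | "j = n" "1 \<le> j" | "1 \<le> j" "j < n" using j n by linarith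
  then have less: "\<bar>\<Prod>i\<in>I. f (d i)\<bar> < \<bar>\<Prod>i\<in>I. f (c i)\<bar>"
  proof cases
    case 1
    then have "I = {Suc j}" using n by (auto simp: I_def)
    then show ?thesis using move_right[of "c (Suc j)" t x] pos t out 1 by (simp add: d_def f_def)
  next
    case 2
    then have "I = {j}" by (auto simp: I_def)
    then show ?thesis using move_left[of x t "c j"] x t out 2 by (simp add: d_def f_def)
  next
    case 3
    then have "I = {j, Suc j}" by (auto simp: I_def)
    then show ?thesis using move_apart[of "c j" "c (Suc j)" t x] pos x t out 3 \<open>c j \<le> c (Suc j)\<close>
      by (simp add: d_def f_def)
  qed
  show ?thesis
  proof (cases "(\<Prod>i\<in>{1..n} - I. f (c i)) = 0")
    case True
    then show ?thesis unfolding split[of d] rest by simp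
  next
    case False
    then show ?thesis unfolding split[of d] split[of c] rest abs_mult
      by (intro disjI2 mult_strict_right_mono less) simp
  qed
qed

text \<open>
  The hypotheses on \<open>c j\<close> and \<open>c (Suc j)\<close> leave room to spread the gap slightly.  By minimality every
  spread product still reaches \<open>M\<close>, and by \<open>spread_reduces\<close> it does so inside the spread gap.  As the
  spreading tends to zero, these points accumulate at a point of the gap at which the original
  product reaches \<open>M\<close>.
\<close>

lemma interior_gap_attains:
  assumes min: "minimal_blaschke n a c M" and a: "0 < a" and n: "1 \<le> n"
    and mono: "mono c" and c0: "c 0 = a" and c1: "c (Suc n) = 1" and M: "0 < M" and j: "j \<le> n"
    and low: "1 \<le> j \<Longrightarrow> a < c j" and high: "j < n \<Longrightarrow> c (Suc j) < 1"
  shows "\<exists>x\<in>{c j..c (Suc j)}. M \<le> \<bar>blaschke n c x\<bar>"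
proof -
  have ca: "a \<le> c i" for i using monoD[OF mono, of 0 i] c0 by simp
  have pos: "0 < c i" for i using ca[of i] a by linarith
  have cle1: "c i \<le> 1" if "i \<le> Suc n" for i using monoD[OF mono that] c1 by simp
  define t where "t k = 1 + 1 / real (Suc k)" for k
  define D where "D k = c(j := c j / t k, Suc j := c (Suc j) * t k)" for k
  have t1: "1 < t k" for k by (simp add: t_def)
  have tlim: "t \<longlonglongrightarrow> 1"
  proof -
    have "(\<lambda>k. 1 + 1 / real (Suc k)) \<longlonglongrightarrow> 1 + 0"
      by (intro tendsto_add tendsto_const LIMSEQ_Suc lim_const_over_n)
    then show ?thesis by (simp add: t_def[abs_def])
  qed
  have lo: "(\<lambda>k. c j / t k) \<longlonglongrightarrow> c j / 1" by (intro tendsto_divide tendsto_const tlim) simp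
  have hi: "(\<lambda>k. c (Suc j) * t k) \<longlonglongrightarrow> c (Suc j) * 1" by (intro tendsto_mult tendsto_const tlim)
  have "eventually (\<lambda>k. 1 \<le> j \<longrightarrow> a < c j / t k) sequentially"
    using order_tendstoD(1)[OF lo, of a] low by (cases "1 \<le> j") (auto elim: eventually_mono)
  moreover have "eventually (\<lambda>k. j < n \<longrightarrow> c (Suc j) * t k < 1) sequentially"
    using order_tendstoD(2)[OF hi, of 1] high by (cases "j < n") (auto elim: eventually_mono)
  ultimately have "eventually (\<lambda>k. (1 \<le> j \<longrightarrow> a < c j / t k) \<and> (j < n \<longrightarrow> c (Suc j) * t k < 1)) sequentially"
    by (rule eventually_conj)
  then obtain N where N: "\<And>k. N \<le> k \<Longrightarrow> 1 \<le> j \<Longrightarrow> a < c j / t k"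
      "\<And>k. N \<le> k \<Longrightarrow> j < n \<Longrightarrow> c (Suc j) * t k < 1"
    by (auto simp: eventually_sequentially)
  have adm: "D (k + N) i \<in> {a..1}" if i: "i \<in> {1..n}" for k i
  proof -
    have "c j / t (k + N) \<le> c j" using t1[of "k + N"] pos[of j] by (simp add: field_simps)
    moreover have "c (Suc j) \<le> c (Suc j) * t (k + N)" using t1[of "k + N"] pos[of "Suc j"] by simp
    ultimately show ?thesis
      using i j N[of "k + N"] ca[of i] ca[of "Suc j"] cle1[of i] cle1[of j] by (auto simp: D_def)
  qed
  have "\<exists>x\<in>{a..1}. M \<le> \<bar>blaschke n (D (k + N)) x\<bar>" for k
    using min adm unfolding minimal_blaschke_def by blast
  then obtain x where x: "\<And>k. x k \<in> {a..1}" "\<And>k. M \<le> \<bar>blaschke n (D (k + N)) (x k)\<bar>"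
    by metis
  have xin: "x k \<in> {c j / t (k + N)..c (Suc j) * t (k + N)}" for k
  proof (rule ccontr)
    assume no: "x k \<notin> {c j / t (k + N)..c (Suc j) * t (k + N)}"
    have t': "1 < t (k + N)" by (rule t1)
    have x0: "0 < x k" using x(1)[of k] a by simp
    have "1 \<le> j" if "x k < c j / t (k + N)"
    proof (rule ccontr)
      assume "\<not> 1 \<le> j"
      then have "c j / t (k + N) < a" using c0 a t' by (cases j) (simp_all add: field_simps)
      then show False using that x(1)[of k] by simp
    qed
    moreover have "j < n" if "c (Suc j) * t (k + N) < x k"
    proof (rule ccontr)
      assume "\<not> j < n"
      then have "1 < c (Suc j) * t (k + N)" using c1 j t' by simp
      then show False using that x(1)[of k] by simp
    qed
    ultimately have "(1 \<le> j \<and> x k < c j / t (k + N)) \<or> (j < n \<and> c (Suc j) * t (k + N) < x k)"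
      using no by auto
    from spread_reduces[OF pos mono n j t' x0 this]
    have "blaschke n (D (k + N)) (x k) = 0 \<or> \<bar>blaschke n (D (k + N)) (x k)\<bar> < \<bar>blaschke n c (x k)\<bar>"
      by (simp only: D_def)
    moreover have "\<bar>blaschke n c (x k)\<bar> \<le> M" using min x(1) by (simp add: minimal_blaschke_def)
    ultimately show False using x(2)[of k] M by auto
  qed
  obtain l r where l: "l \<in> {a..1}" "strict_mono r" "(x \<circ> r) \<longlonglongrightarrow> l"
    using seq_compactE[OF compact_imp_seq_compact[OF compact_Icc[of a 1]], of x] x(1) by blast
  have xl: "(\<lambda>k. x (r k)) \<longlonglongrightarrow> l" using l(3) by (simp add: o_def)
  have tr: "(\<lambda>k. t (r k + N)) \<longlonglongrightarrow> 1"
    using LIMSEQ_subseq_LIMSEQ[OF LIMSEQ_ignore_initial_segment[OF tlim, of N] l(2)] by (simp add: o_def)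
  have lo': "(\<lambda>k. c j / t (r k + N)) \<longlonglongrightarrow> c j"
    using tendsto_divide[OF tendsto_const tr, of "c j"] by simp
  have hi': "(\<lambda>k. c (Suc j) * t (r k + N)) \<longlonglongrightarrow> c (Suc j)"
    using tendsto_mult[OF tendsto_const tr, of "c (Suc j)"] by simp
  have "c j \<le> l" by (rule LIMSEQ_le[OF lo' xl]) (use xin in auto)
  moreover have "l \<le> c (Suc j)" by (rule LIMSEQ_le[OF xl hi']) (use xin in auto)
  moreover have "M \<le> \<bar>blaschke n c l\<bar>"
  proof (rule LIMSEQ_le_const)
    show "(\<lambda>k. \<bar>blaschke n (D (r k + N)) (x (r k))\<bar>) \<longlonglongrightarrow> \<bar>blaschke n c l\<bar>"
    proof (intro tendsto_rabs tendsto_blaschke xl pos)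
      show "0 < l" using l(1) a by simp
      show "(\<lambda>k. D (r k + N) i) \<longlonglongrightarrow> c i" for i
        unfolding D_def using lo' hi' by (cases "i = j"; cases "i = Suc j") simp_all
    qed
  qed (use x(2) in auto)
  ultimately show ?thesis by auto
qed

text \<open>
  If the first zero were at \<open>1\<close>, the first gap would be the whole interval; so it attains \<open>M\<close> in any
  case, and likewise the last gap.  As the product vanishes at its zeros, these gaps are not single
  points, which gives the other gaps the room that \<open>interior_gap_attains\<close> needs.
\<close>

lemma every_gap_attains:
  assumes min: "minimal_blaschke n a c M" and a: "0 < a" and n: "1 \<le> n"
    and mono: "mono c" and c0: "c 0 = a" and c1: "c (Suc n) = 1" and M: "0 < M" and j: "j \<le> n"
  shows "\<exists>x\<in>{c j..c (Suc j)}. M \<le> \<bar>blaschke n c x\<bar>"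
proof -
  have "\<forall>i\<in>{1..n}. c i \<in> {a..1}" using min by (simp add: minimal_blaschke_def)
  then obtain x where x: "x \<in> {a..1}" "M \<le> \<bar>blaschke n c x\<bar>"
    using min unfolding minimal_blaschke_def by blast
  have ca: "a \<le> c i" for i using monoD[OF mono, of 0 i] c0 by simp
  have cle1: "c i \<le> 1" if "i \<le> Suc n" for i using monoD[OF mono that] c1 by simp
  note gap = interior_gap_attains[OF min a n mono c0 c1 M]
  have zero: "blaschke n c (c i) = 0" if "i \<in> {1..n}" for i
    unfolding blaschke_def by (rule prod_zero) (use that in auto)
  have first: "\<exists>x\<in>{c 0..c (Suc 0)}. M \<le> \<bar>blaschke n c x\<bar>"
  proof (cases "c 1 = 1")
    case True
    then show ?thesis using x c0 by auto
  next
    case False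
    then have "c 1 < 1" using cle1[of 1] by simp
    then show ?thesis using gap[of 0] by simp
  qed
  have last: "\<exists>x\<in>{c n..c (Suc n)}. M \<le> \<bar>blaschke n c x\<bar>"
  proof (cases "c n = a")
    case True
    then show ?thesis using x c1 by auto
  next
    case False
    then have "a < c n" using ca[of n] by simp
    then show ?thesis using gap[of n] by simp
  qed
  have ends: "a < c 1" "c n < 1"
  proof -
    show "a < c 1"
    proof (rule ccontr)
      assume "\<not> a < c 1"
      then have "c 1 = a" using ca[of 1] by simp
      then have "{c 0..c (Suc 0)} = {c 1}" using c0 by simp
      with first zero[of 1] n M show False by auto
    qed
    show "c n < 1"
    proof (rule ccontr)
      assume "\<not> c n < 1"
      then have "c n = 1" using cle1[of n] by simp
      then have "{c n..c (Suc n)} = {c n}" using c1 by simp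
      with last zero[of n] n M show False by auto
    qed
  qed
  have "a < c j" if "1 \<le> j" using monoD[OF mono that] ends by simp
  moreover have "c (Suc j) < 1" if "j < n" using monoD[OF mono, of "Suc j" n] that ends by simp
  ultimately show ?thesis by (rule gap[OF j])
qed

lemma abs_blaschke_less_1:
  assumes "1 \<le> n" "\<And>i. i \<in> {1..n} \<Longrightarrow> 0 < c i" "0 < x"
  shows "\<bar>blaschke n c x\<bar> < 1"
proof -
  have f: "\<bar>(c i - x) / (c i + x)\<bar> < 1" if "i \<in> {1..n}" for i
    by (intro blaschke_factor_less_1 assms that)
  have "\<bar>blaschke n c x\<bar> = (\<Prod>i\<in>{1..n}. \<bar>(c i - x) / (c i + x)\<bar>)"
    unfolding blaschke_def by (rule abs_prod)
  also have "\<dots> = \<bar>(c 1 - x) / (c 1 + x)\<bar> * (\<Prod>i\<in>{1..n} - {1}. \<bar>(c i - x) / (c i + x)\<bar>)"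
    by (rule prod.remove) (use assms(1) in auto)
  also have "\<dots> \<le> \<bar>(c 1 - x) / (c 1 + x)\<bar> * 1"
    by (intro mult_left_mono prod_le_1) (use f in \<open>auto simp: less_imp_le\<close>)
  also have "\<dots> < 1" using f[of 1] assms(1) by simp
  finally show ?thesis .
qed

lemma minimal_blaschke_bounds:
  assumes min: "minimal_blaschke n a c M" and a: "0 < a" "a < 1" and n: "1 \<le> n"
  shows "0 < M" "M < 1"
proof -
  have c: "c i \<in> {a..1}" if "i \<in> {1..n}" for i using min that by (simp add: minimal_blaschke_def)
  have pos: "0 < c i" if "i \<in> {1..n}" for i using c[OF that] a by simp
  obtain x where x: "x \<in> {a..1}" "M \<le> \<bar>blaschke n c x\<bar>"
    using min c unfolding minimal_blaschke_def by blast
  then show "M < 1" using abs_blaschke_less_1[OF n, of c x] pos a by force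
  have "infinite ({a..1} - c ` {1..n})" using infinite_Icc[OF a(2)] by (simp add: Diff_infinite_finite)
  then obtain y where y: "y \<in> {a..1}" "y \<notin> c ` {1..n}"
    by (metis Diff_iff finite.emptyI ex_in_conv)
  have "blaschke n c y \<noteq> 0" unfolding blaschke_def
  proof (subst prod_zero_iff, simp, clarify)
    fix i assume i: "i \<in> {1..n}" "(c i - y) / (c i + y) = 0"
    then have "c i \<noteq> y" using y by auto
    moreover have "0 < c i + y" using pos[OF i(1)] y(1) a by simp
    ultimately show False using i(2) by simp
  qed
  moreover have "\<bar>blaschke n c y\<bar> \<le> M" using min y(1) by (simp add: minimal_blaschke_def)
  ultimately show "0 < M" by auto
qed

text \<open>
  Between an endpoint and the nearest zero every factor is monotone in modulus.  So in the outer
  gaps the maximum can only be attained at the endpoints \<open>a\<close> and \<open>1\<close>.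
\<close>

lemma endpoint_dominates:
  fixes c :: "nat \<Rightarrow> real"
  assumes n: "1 \<le> n" and pos: "0 < x" "\<And>i. i \<in> {1..n} \<Longrightarrow> 0 < c i" "0 < y"
    and cl: "\<And>i. i \<in> {1..n} \<Longrightarrow> (x < y \<and> y < c i) \<or> (c i < y \<and> y < x)"
  shows "\<bar>blaschke n c y\<bar> < \<bar>blaschke n c x\<bar>"
proof -
  let ?f = "\<lambda>i. \<bar>(c i - y) / (c i + y)\<bar>" and ?g = "\<lambda>i. \<bar>(c i - x) / (c i + x)\<bar>"
  have less: "0 < ?f i \<and> ?f i < ?g i" if i: "i \<in> {1..n}" for i
  proof -
    have ci: "0 < c i" using pos i by blast
    show ?thesis using cl[OF i]
    proof
      assume "x < y \<and> y < c i"
      then show ?thesis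
        using fraction_strict_antimono[of x y "c i"] pos(1,3) ci
        unfolding abs_blaschke_factor[OF ci pos(3)] abs_blaschke_factor[OF ci pos(1)] by simp
    next
      assume "c i < y \<and> y < x"
      then have "\<bar>c i - y\<bar> = - (c i - y)" "\<bar>c i - x\<bar> = - (c i - x)" "0 < - (c i - y)" by simp_all
      moreover have "- ((c i - y) / (c i + y)) < - ((c i - x) / (c i + x))"
        using fraction_strict_antimono[of y x "c i"] \<open>c i < y \<and> y < x\<close> pos(3) ci by simp
      ultimately show ?thesis
        unfolding abs_blaschke_factor[OF ci pos(3)] abs_blaschke_factor[OF ci pos(1)]
        using ci pos(3) by (simp only: minus_divide_left divide_pos_pos add_pos_pos simp_thms)
    qed
  qed
  have "(\<Prod>i\<in>{1..n}. ?f i) < (\<Prod>i\<in>{1..n}. ?g i)"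
  proof (rule prod_mono_strict[of 1])
    show "0 \<le> ?f i \<and> ?f i \<le> ?g i" if "i \<in> {1..n}" for i using less[OF that] by simp
    show "0 < ?g i" if "i \<in> {1..n}" for i using less[OF that] by linarith
  qed (use n less in auto)
  then show ?thesis unfolding blaschke_def abs_prod .
qed

section \<open>Existence of equioscillating functions\<close>

text \<open>
  The even and the odd part of \<open>\<Prod>i. (c i + x)\<close> become the numerator and denominator of an extremal
  function.  Replacing \<open>x\<close> by \<open>- x\<close> yields the numerator of the Blaschke product.
\<close>

lemma even_odd_parts:
  fixes c :: "nat \<Rightarrow> real"
  assumes n: "1 \<le> n" and "\<And>i. 1 \<le> i \<Longrightarrow> i \<le> n \<Longrightarrow> 0 < c i"
  shows "\<exists>A B :: real poly. degree A \<le> n div 2 \<and> degree B \<le> (n - 1) div 2 \<and>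
    (\<forall>z>0. 0 < poly A z \<and> 0 < poly B z) \<and>
    (\<forall>x. (\<Prod>i=1..n. c i + x) = poly A (x\<^sup>2) + x * poly B (x\<^sup>2))"
  using assms
proof (induction n rule: nat_induct_at_least)
  case base
  show ?case
    by (rule exI[of _ "[:c 1:]"], rule exI[of _ 1]) (use base in auto)
next
  case (Suc n)
  then obtain A B :: "real poly" where A: "degree A \<le> n div 2" and B: "degree B \<le> (n - 1) div 2"
    and pos: "\<And>z. 0 < z \<Longrightarrow> 0 < poly A z" "\<And>z. 0 < z \<Longrightarrow> 0 < poly B z"
    and eq: "\<And>x. (\<Prod>i=1..n. c i + x) = poly A (x\<^sup>2) + x * poly B (x\<^sup>2)" by auto
  let ?c = "c (Suc n)"
  have c: "0 < ?c" using Suc by simp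
  have "degree (pCons 0 B) \<le> Suc n div 2"
    using degree_pCons_le[of 0 B] B Suc.hyps by simp
  then have "degree (smult ?c A + pCons 0 B) \<le> Suc n div 2"
    using A by (intro degree_add_le order_trans[OF degree_smult_le]) simp_all
  moreover have "degree (A + smult ?c B) \<le> (Suc n - 1) div 2"
    using A B by (intro degree_add_le order_trans[OF degree_smult_le]) simp_all
  moreover have "0 < poly (smult ?c A + pCons 0 B) z \<and> 0 < poly (A + smult ?c B) z" if "0 < z" for z
    using pos[OF that] c that by (auto intro: add_pos_pos)
  moreover have "(\<Prod>i=1..Suc n. c i + x) =
      poly (smult ?c A + pCons 0 B) (x\<^sup>2) + x * poly (A + smult ?c B) (x\<^sup>2)" for x
    using eq[of x] by (simp add: power2_eq_square algebra_simps)
  ultimately show ?case by blast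
qed

text \<open>
  The points \<open>y j\<close> are points of the gaps at which the minimal product attains its maximal
  modulus.  They separate its zeros, so passing from \<open>y j\<close> to \<open>y (Suc j)\<close> changes the sign of exactly
  one factor.
\<close>

lemma alternation_points_exist:
  assumes n: "1 \<le> n" and a: "0 < a" "a < 1"
  obtains c M y where "\<And>i. 0 < c i" "0 < M" "M < 1" "\<And>x. x \<in> {a..1} \<Longrightarrow> \<bar>blaschke n c x\<bar> \<le> M"
    "strict_mono_on {..n} y" "y 0 = a" "y n = 1" "\<And>j. j \<le> n \<Longrightarrow> blaschke n c (y j) = (-1) ^ j * M"
proof -
  obtain c' M where min': "minimal_blaschke n a c' M" using minimal_blaschke_exists[OF a] by blast
  obtain c where c: "mono c" "c 0 = a" "c (Suc n) = 1" "\<And>i. c i \<in> {a..1}" "blaschke n c = blaschke n c'"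
    using blaschke_sorted[of n c' a] min' a by (auto simp: minimal_blaschke_def)
  have min: "minimal_blaschke n a c M" using min' c(4,5) by (simp add: minimal_blaschke_def)
  have pos: "0 < c i" for i using c(4)[of i] a by simp
  note M = minimal_blaschke_bounds[OF min a n]
  have le: "\<bar>blaschke n c x\<bar> \<le> M" if "x \<in> {a..1}" for x
    using min that by (simp add: minimal_blaschke_def)
  have zero: "blaschke n c (c i) = 0" if "i \<in> {1..n}" for i
    unfolding blaschke_def by (rule prod_zero) (use that in auto)
  have "\<forall>j. \<exists>x. j \<le> n \<longrightarrow> x \<in> {c j..c (Suc j)} \<and> M \<le> \<bar>blaschke n c x\<bar>"
    using every_gap_attains[OF min a(1) n c(1-3) M(1)] by blast
  then obtain y where y: "\<And>j. j \<le> n \<Longrightarrow> y j \<in> {c j..c (Suc j)}" "\<And>j. j \<le> n \<Longrightarrow> M \<le> \<bar>blaschke n c (y j)\<bar>"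
    by metis
  have yc: "y j \<noteq> c i" if "j \<le> n" "i \<in> {1..n}" for i j using y(2)[OF that(1)] zero[OF that(2)] M by auto
  have lo: "c i < y j" if "j \<le> n" "1 \<le> i" "i \<le> j" for i j
    using y(1)[OF that(1)] yc[of j i] monoD[OF c(1) that(3)] that by force
  have hi: "y j < c i" if "i \<le> n" "j < i" for i j
    using y(1)[of j] yc[of j i] monoD[OF c(1), of "Suc j" i] that by force
  have yin: "y j \<in> {a..1}" if "j \<le> n" for j using y(1)[OF that] c(4)[of j] c(4)[of "Suc j"] by simp
  have abs: "\<bar>blaschke n c (y j)\<bar> = M" if "j \<le> n" for j using y(2)[OF that] le[OF yin[OF that]] by simp
  have "strict_mono_on {..n} y"
  proof (rule strict_mono_on_atMostI)
    fix j assume "j < n"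
    then have "y j < c (Suc j)" "c (Suc j) < y (Suc j)" using hi[of "Suc j" j] lo[of "Suc j" "Suc j"] by simp_all
    then show "y j < y (Suc j)" by (rule less_trans)
  qed
  moreover have "y 0 = a"
  proof (rule ccontr)
    assume "y 0 \<noteq> a"
    then have "a < y 0" using yin[of 0] by simp
    then have "\<bar>blaschke n c (y 0)\<bar> < \<bar>blaschke n c a\<bar>"
      using hi a by (intro endpoint_dominates n pos) auto
    then show False using abs[of 0] le[of a] a by simp
  qed
  moreover have "y n = 1"
  proof (rule ccontr)
    assume "y n \<noteq> 1"
    then have "y n < 1" "0 < y n" using yin[of n] a by auto
    then have "\<bar>blaschke n c (y n)\<bar> < \<bar>blaschke n c 1\<bar>"
      using lo by (intro endpoint_dominates n pos) auto
    then show False using abs[of n] le[of 1] a by simp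
  qed
  moreover have "blaschke n c (y j) = (-1) ^ j * M" if j: "j \<le> n" for j
  proof -
    let ?f = "\<lambda>i. (c i - y j) / (c i + y j)"
    have y0: "0 < y j" using yin[OF j] a by simp
    have "(-1) ^ j * (\<Prod>i\<in>{1..j}. ?f i) = (\<Prod>i\<in>{1..j}. - 1 * ?f i)"
      by (subst prod.distrib) simp
    also have "0 < \<dots>"
      using lo[OF j] pos y0 by (intro prod_pos) (auto simp: field_simps add_pos_pos divide_pos_neg intro: mult_pos_pos)
    finally have "0 < (-1) ^ j * (\<Prod>i\<in>{1..j}. ?f i)" .
    moreover have "0 < (\<Prod>i\<in>{Suc j..n}. ?f i)"
      using hi[of _ j] pos y0 by (intro prod_pos divide_pos_pos) (auto intro: add_pos_pos)
    moreover have "blaschke n c (y j) = (\<Prod>i\<in>{1..j}. ?f i) * (\<Prod>i\<in>{Suc j..n}. ?f i)"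
      unfolding blaschke_def
      by (subst prod.union_disjoint[symmetric]) (use j in \<open>auto intro: prod.cong\<close>)
    ultimately have "0 < (-1) ^ j * blaschke n c (y j)" by (simp flip: mult.assoc)
    then show ?thesis using abs[OF j] by (cases "even j") auto
  qed
  ultimately show ?thesis using that[of c M y] pos M le by blast
qed

lemma cayley_bounds:
  fixes r M :: real
  assumes "\<bar>r\<bar> \<le> M" "M < 1"
  shows "((1 - M) / (1 + M))\<^sup>2 \<le> (1 - r) / (1 + r) * ((1 - M) / (1 + M))"
    "(1 - r) / (1 + r) * ((1 - M) / (1 + M)) \<le> 1"
proof -
  have r: "- M \<le> r" "r \<le> M" "0 < 1 + r" "0 < 1 + M" "0 < 1 - M" using assms by auto
  have "(1 - M) / (1 + M) \<le> (1 - r) / (1 + r)" using r by (intro frac_le) auto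
  then show "((1 - M) / (1 + M))\<^sup>2 \<le> (1 - r) / (1 + r) * ((1 - M) / (1 + M))"
    unfolding power2_eq_square using r by (intro mult_right_mono) auto
  have "(1 - r) / (1 + r) \<le> (1 + M) / (1 - M)" using r by (intro frac_le) auto
  then have "(1 - r) / (1 + r) * ((1 - M) / (1 + M)) \<le> (1 + M) / (1 - M) * ((1 - M) / (1 + M))"
    using r by (intro mult_right_mono) auto
  then show "(1 - r) / (1 + r) * ((1 - M) / (1 + M)) \<le> 1" using r by simp
qed

text \<open>
  If \<open>A\<close> and \<open>B\<close> are the even and odd part, the Blaschke product is
  \<open>(A - x B) / (A + x B)\<close>, and its Cayley transform is \<open>x B / A\<close>.  The factor \<open>k\<close> makes the maximum of
  this transform \<open>1\<close>; the minimum is then \<open>k\<^sup>2\<close>.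
\<close>

lemma equioscillating_exists:
  assumes n: "1 \<le> n" and a: "0 < a" "a < 1"
  obtains b g where "0 < b" "b < 1" "equioscillating n a b g"
proof -
  obtain c M y where c: "\<And>i. 0 < c i" and M: "0 < M" "M < 1"
    and le: "\<And>x. x \<in> {a..1} \<Longrightarrow> \<bar>blaschke n c x\<bar> \<le> M"
    and y: "strict_mono_on {..n} y" "y 0 = a" "y n = 1"
    and alt: "\<And>j. j \<le> n \<Longrightarrow> blaschke n c (y j) = (-1) ^ j * M"
    using alternation_points_exist[OF n a] by blast
  obtain A B :: "real poly" where A: "degree A \<le> n div 2" and B: "degree B \<le> (n - 1) div 2"
    and pos: "\<And>z. 0 < z \<Longrightarrow> 0 < poly A z" "\<And>z. 0 < z \<Longrightarrow> 0 < poly B z"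
    and eq: "\<And>x. (\<Prod>i=1..n. c i + x) = poly A (x\<^sup>2) + x * poly B (x\<^sup>2)"
    using even_odd_parts[of n c] n c by blast
  define k where "k = (1 - M) / (1 + M)"
  define g where "g = Fract (smult (1 / k) A) B"
  have k: "0 < k" "k < 1" using M by (auto simp: k_def)
  have ratio: "\<not> rf_pole g (x\<^sup>2)" "sqrt_ratio g x = (1 - blaschke n c x) / (1 + blaschke n c x) * k"
    if x: "0 < x" for x
  proof -
    have AB: "0 < poly A (x\<^sup>2)" "0 < poly B (x\<^sup>2)" using pos x by simp_all
    have v: "has_rf_value g (x\<^sup>2) (poly (smult (1 / k) A) (x\<^sup>2) / poly B (x\<^sup>2))"
      unfolding g_def by (rule has_rf_value_Fract) (use AB in simp)
    then show "\<not> rf_pole g (x\<^sup>2)" by (simp add: has_rf_value_def)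
    have sr: "sqrt_ratio g x = x * poly B (x\<^sup>2) / poly A (x\<^sup>2) * k"
      using v AB k by (simp add: has_rf_value_def sqrt_ratio_def)
    define S where "S = poly A (x\<^sup>2) + x * poly B (x\<^sup>2)"
    have S: "0 < S" using AB x by (simp add: S_def add_pos_pos)
    have "blaschke n c x = (poly A (x\<^sup>2) - x * poly B (x\<^sup>2)) / S"
      unfolding blaschke_def prod_dividef using eq[of x] eq[of "-x"] by (simp add: S_def)
    then have "1 - blaschke n c x = 2 * (x * poly B (x\<^sup>2)) / S" "1 + blaschke n c x = 2 * poly A (x\<^sup>2) / S"
      using S by (simp_all add: field_simps S_def)
    then have "(1 - blaschke n c x) / (1 + blaschke n c x) = x * poly B (x\<^sup>2) / poly A (x\<^sup>2)"
      using S by simp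
    then show "sqrt_ratio g x = (1 - blaschke n c x) / (1 + blaschke n c x) * k" using sr by simp
  qed
  have "equioscillating n a (k\<^sup>2) g" unfolding equioscillating_def
  proof (intro conjI exI[of _ y] y ballI allI impI)
    have "degree (smult (1 / k) A) \<le> n div 2" using A degree_smult_le order_trans by blast
    moreover have "B \<noteq> 0" using pos(2)[of 1] by auto
    ultimately show "g \<in> rat_type (n div 2) ((n - 1) div 2)"
      using B unfolding g_def rat_type_def by blast
    fix x assume x: "x \<in> {a..1}"
    then have x0: "0 < x" using a by simp
    show "\<not> rf_pole g (x\<^sup>2)" by (rule ratio[OF x0])
    show "sqrt_ratio g x \<in> {k\<^sup>2..1}"
      unfolding ratio(2)[OF x0] k_def using cayley_bounds[OF le[OF x] M(2)] by simp
  next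
    fix j assume j: "j \<le> n"
    have "0 < y j" using strict_mono_on_leD[OF y(1), of 0 j] j y(2) a by simp
    then show "sqrt_ratio g (y j) = (if even j then k\<^sup>2 else 1)"
      unfolding ratio(2)[OF \<open>0 < y j\<close>] alt[OF j] using M
      by (auto simp: k_def power2_eq_square)
  qed
  moreover have "0 < k\<^sup>2" "k\<^sup>2 < 1" using k by (simp_all add: power_less_one_iff)
  ultimately show ?thesis using that by blast
qed

section \<open>Composition\<close>

lemma level_points:
  fixes \<phi> :: "real \<Rightarrow> real" and w :: "nat \<Rightarrow> real"
  assumes "1 \<le> m" "p < q" "continuous_on {p..q} \<phi>" "strict_mono_on {..m} w" "\<phi> p = w 0" "\<phi> q = w m"
  shows "\<exists>u. strict_mono_on {..m} u \<and> u 0 = p \<and> u m = q \<and> (\<forall>i\<le>m. \<phi> (u i) = w i)"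
  using assms
proof (induction m arbitrary: q rule: nat_induct_at_least)
  case base
  show ?case
    by (rule exI[of _ "\<lambda>i. if i = 0 then p else q"])
      (use base in \<open>auto simp: strict_mono_on_def le_Suc_eq\<close>)
next
  case (Suc m)
  have w: "w 0 < w m" "w m < w (Suc m)" using Suc.prems(3) Suc.hyps by (auto simp: strict_mono_on_def)
  obtain v where v: "p \<le> v" "v \<le> q" "\<phi> v = w m"
    using IVT'[of \<phi> p "w m" q] w Suc.prems by auto
  have "v \<noteq> p" "v \<noteq> q" using v w Suc.prems by auto
  then have pv: "p < v" "v < q" using v by simp_all
  have "strict_mono_on {..m} w" using Suc.prems(3) by (auto simp: strict_mono_on_def)
  then obtain u where u: "strict_mono_on {..m} u" "u 0 = p" "u m = v" "\<And>i. i \<le> m \<Longrightarrow> \<phi> (u i) = w i"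
    using Suc.IH[OF pv(1)] continuous_on_subset[OF Suc.prems(2)] Suc.prems(4) v pv by force
  define u' where "u' = u(Suc m := q)"
  have "strict_mono_on {..Suc m} u'"
  proof (rule strict_mono_on_atMostI)
    fix j assume "j < Suc m"
    then show "u' j < u' (Suc j)"
      using u(1,3) pv by (cases "j = m") (auto simp: u'_def strict_mono_on_def)
  qed
  moreover have "u' 0 = p" "u' (Suc m) = q" using u by (simp_all add: u'_def)
  moreover have "\<phi> (u' i) = w i" if "i \<le> Suc m" for i
    using that u Suc.prems(5) by (auto simp: u'_def le_Suc_eq)
  ultimately show ?case by blast
qed

text \<open>
  Between \<open>y j\<close> and \<open>y (Suc j)\<close> the function \<open>\<phi>\<close> passes the levels \<open>w 0, \<dots>, w m\<close> upwards for even \<open>j\<close> and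
  downwards for odd \<open>j\<close>.  Neighbouring pieces share the point at their common end, so the index of
  the level changes by one from each of the \<open>n * m + 1\<close> points to the next.  It starts at \<open>0\<close>, hence
  its parity is that of the position.
\<close>

lemma refine_alternation:
  fixes \<phi> :: "real \<Rightarrow> real" and w y :: "nat \<Rightarrow> real"
  assumes m: "1 \<le> m" and n: "1 \<le> n"
    and y: "strict_mono_on {..n} y" and w: "strict_mono_on {..m} w"
    and cont: "continuous_on {y 0..y n} \<phi>"
    and osc: "\<And>j. j \<le> n \<Longrightarrow> \<phi> (y j) = (if even j then w 0 else w m)"
  obtains Y i where "strict_mono_on {..n * m} Y" "Y 0 = y 0" "Y (n * m) = y n"
    "\<And>J. J \<le> n * m \<Longrightarrow> i J \<le> m \<and> \<phi> (Y J) = w (i J) \<and> (even (i J) \<longleftrightarrow> even J)"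
proof -
  define idx where "idx j i = (if even j then i else m - i)" for j i :: nat
  have piece: "\<exists>u. strict_mono_on {..m} u \<and> u 0 = y j \<and> u m = y (Suc j) \<and> (\<forall>i\<le>m. \<phi> (u i) = w (idx j i))"
    if j: "j < n" for j
  proof -
    have yy: "y j < y (Suc j)" using y j by (simp add: strict_mono_on_def)
    have "{y j..y (Suc j)} \<subseteq> {y 0..y n}"
      using strict_mono_on_leD[OF y, of 0 j] strict_mono_on_leD[OF y, of "Suc j" n] j by auto
    then have c: "continuous_on {y j..y (Suc j)} \<phi>" by (rule continuous_on_subset[OF cont])
    show ?thesis
    proof (cases "even j")
      case True
      then show ?thesis using level_points[OF m yy c w] osc[of j] osc[of "Suc j"] j by (simp add: idx_def)
    next
      case False
      have "strict_mono_on {..m} (\<lambda>i. - w (m - i))" using w by (auto simp: strict_mono_on_def)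
      from level_points[OF m yy continuous_on_minus[OF c] this]
      show ?thesis using False osc[of j] osc[of "Suc j"] j by (simp add: idx_def)
    qed
  qed
  then obtain u where u: "\<And>j. j < n \<Longrightarrow> strict_mono_on {..m} (u j)" "\<And>j. j < n \<Longrightarrow> u j 0 = y j"
      "\<And>j. j < n \<Longrightarrow> u j m = y (Suc j)" "\<And>j i. j < n \<Longrightarrow> i \<le> m \<Longrightarrow> \<phi> (u j i) = w (idx j i)"
    by metis
  \<comment> \<open>Position \<open>J = j * m + i\<close> is point \<open>i\<close> of piece \<open>j\<close>; for the last
    position \<open>J div m\<close> would be \<open>n\<close>, beyond the last piece.\<close>
  define Y where "Y J = (if J < n * m then u (J div m) (J mod m) else y n)" for J
  have Y: "Y (j * m + i) = u j i" if j: "j < n" and i: "i \<le> m" for j i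
  proof (cases "i = m")
    case False
    then have im: "i < m" using i by simp
    have "j * m + i < Suc j * m" using im by simp
    also have "\<dots> \<le> n * m" using j by (intro mult_le_mono1) simp
    finally show ?thesis using im by (simp add: Y_def)
  next
    case True
    show ?thesis
    proof (cases "Suc j < n")
      case t: True
      then have "Suc j * m < n * m" using m by (subst mult_less_cancel2) simp
      then show ?thesis using True u(2)[OF t] u(3)[OF j] m by (simp add: Y_def add.commute)
    next
      case False
      then have "n = Suc j" using j by simp
      then show ?thesis using True u(3)[OF j] by (simp add: Y_def)
    qed
  qed
  have decomp: "\<exists>j i. j < n \<and> i \<le> m \<and> J = j * m + i" if "J \<le> n * m" for J
  proof (cases "J = n * m")
    case True
    then show ?thesis using n by (intro exI[of _ "n - 1"] exI[of _ m]) (simp add: diff_mult_distrib)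
  next
    case False
    then have "J div m < n" using that m by (simp add: div_less_iff_less_mult)
    then show ?thesis using m by (intro exI[of _ "J div m"] exI[of _ "J mod m"]) (simp add: less_imp_le)
  qed
  have "strict_mono_on {..n * m} Y"
  proof (rule strict_mono_on_atMostI)
    fix J assume J: "J < n * m"
    then have j: "J div m < n" using m by (simp add: div_less_iff_less_mult)
    have i: "J mod m < m" using m by simp
    have "Y (J div m * m + J mod m) < Y (J div m * m + Suc (J mod m))"
      using u(1)[OF j] i by (subst (1 2) Y[OF j]) (auto simp: strict_mono_on_def)
    then show "Y J < Y (Suc J)" by simp
  qed
  moreover have "Y 0 = y 0" using Y[of 0 0] u(2)[of 0] n by simp
  moreover have "Y (n * m) = y n" by (simp add: Y_def)
  moreover obtain i where "\<And>J. J \<le> n * m \<Longrightarrow> i J \<le> m \<and> \<phi> (Y J) = w (i J) \<and> (even (i J) \<longleftrightarrow> even J)"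
  proof -
    have "\<exists>i. i \<le> m \<and> \<phi> (Y J) = w i \<and> (even i \<longleftrightarrow> even J)" if J: "J \<le> n * m" for J
    proof -
      obtain j i where ji: "j < n" "i \<le> m" "J = j * m + i" using decomp[OF J] by blast
      have "even (idx j i) \<longleftrightarrow> even J" using ji by (auto simp: idx_def even_diff_nat)
      moreover have "idx j i \<le> m" using ji by (simp add: idx_def)
      moreover have "\<phi> (Y J) = w (idx j i)" using u(4)[OF ji(1,2)] Y[OF ji(1,2)] ji(3) by simp
      ultimately show ?thesis by blast
    qed
    then show ?thesis using that by metis
  qed
  ultimately show ?thesis by (rule that)
qed

lemma continuous_on_sqrt_ratio:
  assumes "\<And>x. x \<in> S \<Longrightarrow> \<not> rf_pole g (x\<^sup>2) \<and> sqrt_ratio g x \<noteq> 0"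
  shows "continuous_on S (sqrt_ratio g)"
proof -
  have "continuous_on S (\<lambda>x. x / (poly (fst (quot_of_fract g)) (x\<^sup>2) / poly (snd (quot_of_fract g)) (x\<^sup>2)))"
    by (intro continuous_intros ballI)
      (use assms in \<open>auto simp: rf_pole_def sqrt_ratio_def rf_eval_def\<close>)
  then show ?thesis by (simp add: sqrt_ratio_def[abs_def] rf_eval_def)
qed

lemma equioscillating_compose:
  assumes f: "equioscillating n a b f" and g: "equioscillating m b d g"
    and a: "0 < a" "a < 1" and b: "0 < b" "b < 1" and d: "0 < d"
  shows "equioscillating (n * m) a d (f * rf_compose g (rf_z / f\<^sup>2))"
proof -
  let ?h = "f * rf_compose g (rf_z / f\<^sup>2)"
  obtain y where y: "strict_mono_on {..n} y" "y 0 = a" "y n = 1"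
    and yosc: "\<And>j. j \<le> n \<Longrightarrow> sqrt_ratio f (y j) = (if even j then b else 1)"
    using f by (auto simp: equioscillating_def)
  obtain w where w: "strict_mono_on {..m} w" "w 0 = b" "w m = 1"
    and wosc: "\<And>j. j \<le> m \<Longrightarrow> sqrt_ratio g (w j) = (if even j then d else 1)"
    using g by (auto simp: equioscillating_def)
  have n: "1 \<le> n" using y a by (cases n) auto
  have m: "1 \<le> m" using w b by (cases m) auto
  have arg: "has_rf_value (rf_z / f\<^sup>2) (x\<^sup>2) ((sqrt_ratio f x)\<^sup>2)" if x: "x \<in> {a..1}" for x
  proof -
    note fx = equioscillatingD[OF f a(1) b(1) x]
    have x0: "x \<noteq> 0" "sqrt_ratio f x \<noteq> 0" using x a fx b by auto
    have "has_rf_value (rf_z / (f * f)) (x\<^sup>2) (x\<^sup>2 / (x / sqrt_ratio f x * (x / sqrt_ratio f x)))"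
      by (intro has_rf_value_divide has_rf_value_mult has_rf_value_z fx) (use x0 in auto)
    then show ?thesis using x0 by (simp add: power2_eq_square)
  qed
  have inner: "sqrt_ratio f x \<in> {b..1}" if "x \<in> {a..1}" for x
    using equioscillatingD(2,3)[OF f a(1) b(1) that] by simp
  have val: "has_rf_value ?h (x\<^sup>2) (x / sqrt_ratio g (sqrt_ratio f x))" if x: "x \<in> {a..1}" for x
  proof -
    let ?G = "sqrt_ratio f x"
    note fx = equioscillatingD[OF f a(1) b(1) x] and gx = equioscillatingD[OF g b(1) d inner[OF x]]
    have "has_rf_value ?h (x\<^sup>2) (x / ?G * (?G / sqrt_ratio g ?G))"
      by (intro has_rf_value_mult fx(1) has_rf_value_compose[OF arg[OF x] gx(1)])
    moreover have "?G \<noteq> 0" using inner[OF x] b by auto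
    ultimately show ?thesis by simp
  qed
  have ratio: "sqrt_ratio ?h x = sqrt_ratio g (sqrt_ratio f x)" if x: "x \<in> {a..1}" for x
    using val[OF x] x a equioscillatingD(2)[OF g b(1) d inner[OF x]] d
    by (auto simp: sqrt_ratio_def[of ?h] has_rf_value_def)
  have a1: "a \<in> {a..1}" using a by simp
  have "?h \<in> rat_type (n * m div 2) ((n * m - 1) div 2)"
  proof (rule rat_type_compose[OF _ _ n m])
    show "f \<in> rat_type (n div 2) ((n - 1) div 2)" "g \<in> rat_type (m div 2) ((m - 1) div 2)"
      using f g by (simp_all add: equioscillating_def)
    show "f \<noteq> 0"
      using has_rf_value_nonzero[OF equioscillatingD(1)[OF f a(1) b(1) a1]] inner[OF a1] a b by auto
    have "\<not> rf_pole g ((sqrt_ratio f a)\<^sup>2)"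
      using equioscillatingD(1)[OF g b(1) d inner[OF a1]] by (simp add: has_rf_value_def)
    then show "poly (map_poly rf_const (snd (quot_of_fract g))) (rf_z / f\<^sup>2) \<noteq> 0"
      by (intro has_rf_value_nonzero[OF has_rf_value_poly[OF arg[OF a1]]]) (simp add: rf_pole_def)
  qed
  moreover have "\<not> rf_pole ?h (x\<^sup>2) \<and> sqrt_ratio ?h x \<in> {d..1}" if x: "x \<in> {a..1}" for x
    using val[OF x] ratio[OF x] equioscillatingD(2,3)[OF g b(1) d inner[OF x]] by (simp add: has_rf_value_def)
  moreover have "\<exists>Y. strict_mono_on {..n * m} Y \<and> Y 0 = a \<and> Y (n * m) = 1 \<and>
      (\<forall>J\<le>n * m. sqrt_ratio ?h (Y J) = (if even J then d else 1))"
  proof -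
    have "continuous_on {y 0..y n} (sqrt_ratio f)"
      unfolding y
    proof (rule continuous_on_sqrt_ratio)
      show "\<not> rf_pole f (x\<^sup>2) \<and> sqrt_ratio f x \<noteq> 0" if "x \<in> {a..1}" for x
      proof -
        have "\<not> rf_pole f (x\<^sup>2)" using f that by (simp add: equioscillating_def)
        moreover have "0 < sqrt_ratio f x" using inner[OF that] b by simp
        ultimately show ?thesis by simp
      qed
    qed
    then obtain Y i where Y: "strict_mono_on {..n * m} Y" "Y 0 = y 0" "Y (n * m) = y n"
      and Yi: "\<And>J. J \<le> n * m \<Longrightarrow> i J \<le> m \<and> sqrt_ratio f (Y J) = w (i J) \<and> (even (i J) \<longleftrightarrow> even J)"
      using refine_alternation[OF m n y(1) w(1), of "sqrt_ratio f"] yosc w by metis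
    have "sqrt_ratio ?h (Y J) = (if even J then d else 1)" if J: "J \<le> n * m" for J
    proof -
      have "Y J \<in> {a..1}"
        using strict_mono_on_leD[OF Y(1), of 0 J] strict_mono_on_leD[OF Y(1), of J "n * m"] J Y y by simp
      then show ?thesis using ratio[of "Y J"] Yi[OF J] wosc by simp
    qed
    then show ?thesis using Y y by auto
  qed
  ultimately show ?thesis unfolding equioscillating_def by blast
qed

text \<open>
  The constant \<open>1\<close> has \<open>G(x) = x\<close>, the neutral element of composition, of degree \<open>1\<close> and with
  \<open>b = a\<close>; the iteration starts from it.
\<close>

lemma equioscillating_1:
  assumes a: "0 < a" "a < 1"
  shows "equioscillating 1 a a 1"
proof -
  have "sqrt_ratio 1 x = x" "\<not> rf_pole 1 x" for x by (simp_all add: sqrt_ratio_def rf_eval_def rf_pole_def)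
  moreover have "(1 :: ratfun) \<in> rat_type 0 0"
    unfolding rat_type_def One_fract_def by (auto intro!: exI[of _ "1 :: real poly"])
  moreover have "\<exists>y. strict_mono_on {..1::nat} y \<and> y 0 = a \<and> y 1 = 1 \<and> (\<forall>j\<le>1. y j = (if even j then a else 1))"
    using a by (intro exI[of _ "\<lambda>j. if j = 0 then a else 1"]) (auto simp: strict_mono_on_def le_Suc_eq)
  ultimately show ?thesis unfolding equioscillating_def by simp
qed

text \<open>
  The parameter \<open>b\<close> of the function used in step \<open>k\<close> is its value \<open>G(a k)\<close> at the left endpoint, which
  is how \<open>a (Suc k)\<close> is defined.
\<close>

lemma iterates_equioscillating:
  fixes f :: "nat \<Rightarrow> ratfun" and a :: "nat \<Rightarrow> real"
  assumes N: "1 \<le> N" and \<alpha>: "0 < \<alpha>" "\<alpha> < 1" and f0: "f 0 = 1" and a0: "a 0 = \<alpha>"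
    and f: "\<And>k. f (Suc k) = f k * rf_compose (zolo_rhat (N div 2) ((N - 1) div 2) (a k)) (rf_z / (f k)\<^sup>2)"
    and a: "\<And>k. a (Suc k) = a k / rf_eval (zolo_rhat (N div 2) ((N - 1) div 2) (a k)) ((a k)\<^sup>2)"
  shows "0 < a k \<and> a k < 1 \<and> equioscillating (N ^ k) \<alpha> (a k) (f k)"
proof (induction k)
  case 0
  then show ?case using equioscillating_1[OF \<alpha>] \<alpha> f0 a0 by simp
next
  case (Suc k)
  then have ak: "0 < a k" "a k < 1" and fk: "equioscillating (N ^ k) \<alpha> (a k) (f k)" by simp_all
  obtain b g where b: "0 < b" "b < 1" and g: "equioscillating N (a k) b g"
    using equioscillating_exists[OF N ak] by blast
  have rhat: "zolo_rhat (N div 2) ((N - 1) div 2) (a k) = g"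
    by (rule zolo_rhat_equioscillating[OF g ak b(1)])
  obtain y where "y 0 = a k" "\<forall>j\<le>N. sqrt_ratio g (y j) = (if even j then b else 1)"
    using g by (auto simp: equioscillating_def)
  then have "sqrt_ratio g (a k) = b" by force
  then have "a (Suc k) = b" unfolding a rhat by (simp add: sqrt_ratio_def)
  moreover have "equioscillating (N ^ k * N) \<alpha> b (f (Suc k))"
    unfolding f rhat by (rule equioscillating_compose[OF fk g \<alpha> ak b(1)])
  ultimately show ?case using b by (simp add: mult.commute)
qed

lemma iterates_zolotarev:
  fixes f :: "nat \<Rightarrow> ratfun" and a :: "nat \<Rightarrow> real"
  assumes N: "1 \<le> N" and \<alpha>: "0 < \<alpha>" "\<alpha> < 1" and f0: "f 0 = 1" and a0: "a 0 = \<alpha>"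
    and f: "\<And>k. f (Suc k) = f k * rf_compose (zolo_rhat (N div 2) ((N - 1) div 2) (a k)) (rf_z / (f k)\<^sup>2)"
    and a: "\<And>k. a (Suc k) = a k / rf_eval (zolo_rhat (N div 2) ((N - 1) div 2) (a k)) ((a k)\<^sup>2)"
  shows "f k = zolo_rhat (N ^ k div 2) ((N ^ k - 1) div 2) \<alpha> \<and>
    zolo_rhat (N ^ k div 2) ((N ^ k - 1) div 2) \<alpha>
      = rf_const ((1 + a k) / (2 * a k)) * zolo_r (N ^ k div 2) ((N ^ k - 1) div 2) \<alpha>"
proof -
  have ak: "0 < a k" and eq: "equioscillating (N ^ k) \<alpha> (a k) (f k)"
    using iterates_equioscillating[OF assms] by blast+
  have "(1 + a k) / (2 * a k) * (2 * a k / (1 + a k)) = 1" using ak by simp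
  then have "rf_const ((1 + a k) / (2 * a k)) * (rf_const (2 * a k / (1 + a k)) * f k) = f k"
    by (simp only: mult.assoc[symmetric] rf_const_mult[symmetric] rf_const_1 mult_1)
  then show ?thesis
    unfolding zolo_rhat_equioscillating[OF eq \<alpha> ak] zolo_r_equioscillating[OF eq \<alpha> ak] by simp
qed

theorem theorem2p1:
  fixes m :: nat and \<alpha> :: real
  assumes "m \<ge> 1" and "0 < \<alpha>" and "\<alpha> < 1"
  shows
    "(\<forall>(f :: nat \<Rightarrow> ratfun) (a :: nat \<Rightarrow> real).
        f 0 = 1 \<and> a 0 = \<alpha> \<and>
        (\<forall>k. f (Suc k) = f k * rf_compose (zolo_rhat m (m - 1) (a k)) (rf_z / (f k)\<^sup>2)) \<and>
        (\<forall>k. a (Suc k) = a k / rf_eval (zolo_rhat m (m - 1) (a k)) ((a k)\<^sup>2)) \<longrightarrow>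
        (\<forall>k\<ge>1. let q = (2 * m) ^ k div 2 in
           f k = zolo_rhat q (q - 1) \<alpha> \<and>
           zolo_rhat q (q - 1) \<alpha> = rf_const ((1 + a k) / (2 * a k)) * zolo_r q (q - 1) \<alpha>)) \<and>
     (\<forall>(f :: nat \<Rightarrow> ratfun) (a :: nat \<Rightarrow> real).
        f 0 = 1 \<and> a 0 = \<alpha> \<and>
        (\<forall>k. f (Suc k) = f k * rf_compose (zolo_rhat m m (a k)) (rf_z / (f k)\<^sup>2)) \<and>
        (\<forall>k. a (Suc k) = a k / rf_eval (zolo_rhat m m (a k)) ((a k)\<^sup>2)) \<longrightarrow>
        (\<forall>k\<ge>1. let q = ((2 * m + 1) ^ k - 1) div 2 in
           f k = zolo_rhat q q \<alpha> \<and>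
           zolo_rhat q q \<alpha> = rf_const ((1 + a k) / (2 * a k)) * zolo_r q q \<alpha>))"
proof (intro conjI allI impI; elim conjE)
  fix f :: "nat \<Rightarrow> ratfun" and a :: "nat \<Rightarrow> real" and k :: nat
  assume f0: "f 0 = 1" and a0: "a 0 = \<alpha>" and k: "1 \<le> k"
    and f: "\<forall>k. f (Suc k) = f k * rf_compose (zolo_rhat m (m - 1) (a k)) (rf_z / (f k)\<^sup>2)"
    and a: "\<forall>k. a (Suc k) = a k / rf_eval (zolo_rhat m (m - 1) (a k)) ((a k)\<^sup>2)"
  have N: "1 \<le> 2 * m" "2 * m div 2 = m" "(2 * m - 1) div 2 = m - 1" using assms(1) by auto
  have "even ((2 * m) ^ k)" using k by simp
  then have l: "((2 * m) ^ k - 1) div 2 = (2 * m) ^ k div 2 - 1" by (elim evenE) simp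
  show "let q = (2 * m) ^ k div 2 in
           f k = zolo_rhat q (q - 1) \<alpha> \<and>
           zolo_rhat q (q - 1) \<alpha> = rf_const ((1 + a k) / (2 * a k)) * zolo_r q (q - 1) \<alpha>"
    using iterates_zolotarev[of "2 * m" \<alpha> f a k, unfolded N(2,3) l, OF N(1) assms(2,3) f0 a0] f a
    unfolding Let_def by blast
next
  fix f :: "nat \<Rightarrow> ratfun" and a :: "nat \<Rightarrow> real" and k :: nat
  assume f0: "f 0 = 1" and a0: "a 0 = \<alpha>" and k: "1 \<le> k"
    and f: "\<forall>k. f (Suc k) = f k * rf_compose (zolo_rhat m m (a k)) (rf_z / (f k)\<^sup>2)"
    and a: "\<forall>k. a (Suc k) = a k / rf_eval (zolo_rhat m m (a k)) ((a k)\<^sup>2)"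
  have N: "1 \<le> 2 * m + 1" "(2 * m + 1) div 2 = m" "(2 * m + 1 - 1) div 2 = m" by auto
  have "odd ((2 * m + 1) ^ k)" by simp
  then have l: "(2 * m + 1) ^ k div 2 = ((2 * m + 1) ^ k - 1) div 2" by (elim oddE) simp
  show "let q = ((2 * m + 1) ^ k - 1) div 2 in
           f k = zolo_rhat q q \<alpha> \<and>
           zolo_rhat q q \<alpha> = rf_const ((1 + a k) / (2 * a k)) * zolo_r q q \<alpha>"
    using iterates_zolotarev[of "2 * m + 1" \<alpha> f a k, unfolded N(2,3) l, OF N(1) assms(2,3) f0 a0] f a
    unfolding Let_def by blast
qed

end
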